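(* There exists an algorithm which, given a tree $G$ with $n$ vertices, computes the unigraph number of $G$ in $O(n)$ time.
   Context: Graphs are finite, undirected, simple. A $k$-edge coloring is any function $c:E(G)\to[k]$, $[k]=\{1,\dots,k\}$ (not necessarily proper). The color-$i$ subgraph is the edge-induced subgraph $G[\{e: c(e)=i\}]$. A graph is a unigraph if every graph with the same multiset of vertex degrees is isomorphic to it. A $k$-unigraphic coloring is a $k$-edge coloring whose every color-$i$ subgraph ($i\in[k]$) is a connected unigraph; the unigraph number of $G$ is the minimum $k$ for which $G$ has a $k$-unigraphic coloring. *)

theory Defs
  imports Complex_Main "HOL-Library.Multiset" "HOL-Library.Landau_Symbols"
begin

section \<open>Graphs and the unigraph number\<close>

datatype 'a graph = Graph (verts: "'a set") (edges: "'a set set")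

definition simple_graph :: "'a graph \<Rightarrow> bool" where
  "simple_graph G \<longleftrightarrow> finite (verts G) \<and> (\<forall>e\<in>edges G. e \<subseteq> verts G \<and> card e = 2)"

definition degree :: "'a graph \<Rightarrow> 'a \<Rightarrow> nat" where
  "degree G v = card {e \<in> edges G. v \<in> e}"

definition degree_mset :: "'a graph \<Rightarrow> nat multiset" where
  "degree_mset G = image_mset (degree G) (mset_set (verts G))"

definition graph_iso :: "'a graph \<Rightarrow> 'b graph \<Rightarrow> bool" where
  "graph_iso G H \<longleftrightarrow> (\<exists>f. bij_betw f (verts G) (verts H) \<and>
     (\<forall>u\<in>verts G. \<forall>v\<in>verts G. {u, v} \<in> edges G \<longleftrightarrow> {f u, f v} \<in> edges H))"

text \<open>
  Letting \<open>H\<close> range only over graphs on the same vertex type loses nothing: a graph with the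
  degree multiset of \<open>G\<close> has as many vertices as \<open>G\<close>, so it has an isomorphic copy on the
  vertex set of \<open>G\<close>.
\<close>

definition unigraph :: "'a graph \<Rightarrow> bool" where
  "unigraph G \<longleftrightarrow> simple_graph G \<and>
     (\<forall>H :: 'a graph. simple_graph H \<and> degree_mset H = degree_mset G \<longrightarrow> graph_iso H G)"

definition connected_graph :: "'a graph \<Rightarrow> bool" where
  "connected_graph G \<longleftrightarrow> verts G \<noteq> {} \<and>
     (\<forall>u\<in>verts G. \<forall>v\<in>verts G. (u, v) \<in> {(x, y). {x, y} \<in> edges G}\<^sup>*)"

definition is_cycle :: "'a graph \<Rightarrow> 'a list \<Rightarrow> bool" where
  "is_cycle G p \<longleftrightarrow> length p \<ge> 3 \<and> distinct p \<and>
     (\<forall>i<length p. {p ! i, p ! (Suc i mod length p)} \<in> edges G)"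

definition is_tree :: "'a graph \<Rightarrow> bool" where
  "is_tree G \<longleftrightarrow> simple_graph G \<and> connected_graph G \<and> (\<nexists>p. is_cycle G p)"

definition edge_induced :: "'a set set \<Rightarrow> 'a graph" where
  "edge_induced F = Graph (\<Union>F) F"

definition color_subgraph :: "'a graph \<Rightarrow> ('a set \<Rightarrow> nat) \<Rightarrow> nat \<Rightarrow> 'a graph" where
  "color_subgraph G c i = edge_induced {e \<in> edges G. c e = i}"

definition unigraphic_coloring :: "'a graph \<Rightarrow> nat \<Rightarrow> ('a set \<Rightarrow> nat) \<Rightarrow> bool" where
  "unigraphic_coloring G k c \<longleftrightarrow>
     (\<forall>e\<in>edges G. c e \<in> {1..k}) \<and>
     (\<forall>i\<in>{1..k}. connected_graph (color_subgraph G c i) \<and> unigraph (color_subgraph G c i))"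

text \<open>
  The minimum is over a nonempty set, since giving every edge its own color is always admissible.
  Since \<^const>\<open>connected_graph\<close> excludes the null graph, every color must be used; admitting
  unused colors would not change the minimum. An edgeless graph has unigraph number \<open>0\<close>.
\<close>

definition unigraph_number :: "'a graph \<Rightarrow> nat" where
  "unigraph_number G = (LEAST k. \<exists>c. unigraphic_coloring G k c)"

section \<open>Word RAM programs\<close>

text \<open>
  Structured programs for a random access machine: registers, and a memory consisting of arrays
  whose names are fixed in the program text. A program mentions only finitely many arrays, so
  interleaving them in a single memory costs only a constant factor. Subtraction is truncated.
  \<open>Cell a r\<close> is the entry of array \<open>a\<close> at the index held in register \<open>r\<close>.
\<close>

datatype operand = Const nat | Reg nat | Cell nat nat

datatype expr = Opd operand | Add operand operand | Sub operand operand

datatype test = Less operand operand | Equal operand operand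

datatype com =
    Skip
  | Assign nat expr
  | Write nat nat expr
  | Seq com com
  | Cond test com com
  | While test com

datatype state = State (regs: "nat \<Rightarrow> nat") (arrays: "nat \<Rightarrow> nat \<Rightarrow> nat")

fun operand_val :: "operand \<Rightarrow> state \<Rightarrow> nat" where
  "operand_val (Const k) s = k"
| "operand_val (Reg r) s = regs s r"
| "operand_val (Cell a r) s = arrays s a (regs s r)"

fun expr_val :: "expr \<Rightarrow> state \<Rightarrow> nat" where
  "expr_val (Opd x) s = operand_val x s"
| "expr_val (Add x y) s = operand_val x s + operand_val y s"
| "expr_val (Sub x y) s = operand_val x s - operand_val y s"

fun test_val :: "test \<Rightarrow> state \<Rightarrow> bool" where
  "test_val (Less x y) s \<longleftrightarrow> operand_val x s < operand_val y s"
| "test_val (Equal x y) s \<longleftrightarrow> operand_val x s = operand_val y s"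

definition set_reg :: "nat \<Rightarrow> nat \<Rightarrow> state \<Rightarrow> state" where
  "set_reg r x s = State ((regs s)(r := x)) (arrays s)"

definition set_cell :: "nat \<Rightarrow> nat \<Rightarrow> nat \<Rightarrow> state \<Rightarrow> state" where
  "set_cell a i x s = State (regs s) ((arrays s)(a := (arrays s a)(i := x)))"

text \<open>
  \<open>exec w c s t s'\<close>: started in \<open>s\<close>, the program \<open>c\<close> halts in \<open>s'\<close> after \<open>t\<close> unit-cost steps,
  never storing a value above \<open>w\<close>. There is no rule for an overflowing assignment, so an
  execution that overflows is not derivable.
\<close>

inductive exec :: "nat \<Rightarrow> com \<Rightarrow> state \<Rightarrow> nat \<Rightarrow> state \<Rightarrow> bool" for w :: nat where
  Skip: "exec w Skip s 1 s"
| Assign: "expr_val e s \<le> w \<Longrightarrow> exec w (Assign r e) s 1 (set_reg r (expr_val e s) s)"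
| Write: "expr_val e s \<le> w \<Longrightarrow>
    exec w (Write a r e) s 1 (set_cell a (regs s r) (expr_val e s) s)"
| Seq: "exec w c1 s t1 s1 \<Longrightarrow> exec w c2 s1 t2 s2 \<Longrightarrow> exec w (Seq c1 c2) s (t1 + t2) s2"
| CondTrue: "test_val b s \<Longrightarrow> exec w c1 s t s1 \<Longrightarrow> exec w (Cond b c1 c2) s (1 + t) s1"
| CondFalse: "\<not> test_val b s \<Longrightarrow> exec w c2 s t s1 \<Longrightarrow> exec w (Cond b c1 c2) s (1 + t) s1"
| WhileFalse: "\<not> test_val b s \<Longrightarrow> exec w (While b c) s 1 s"
| WhileTrue: "test_val b s \<Longrightarrow> exec w c s t1 s1 \<Longrightarrow> exec w (While b c) s1 t2 s2 \<Longrightarrow>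
    exec w (While b c) s (1 + t1 + t2) s2"

inductive_cases SkipE: "exec w Skip s t s'"
inductive_cases AssignE: "exec w (Assign r e) s t s'"
inductive_cases WriteE: "exec w (Write a r e) s t s'"
inductive_cases SeqE: "exec w (Seq c1 c2) s t s'"
inductive_cases CondE: "exec w (Cond b c1 c2) s t s'"
inductive_cases WhileE: "exec w (While b c) s t s'"

lemma exec_deterministic:
  "exec w c s t s' \<Longrightarrow> exec w c s t' s'' \<Longrightarrow> t = t' \<and> s' = s''"
proof (induction arbitrary: t' s'' rule: exec.induct)
  case (Skip s)
  then show ?case by (auto elim: SkipE)
next
  case (Assign e s r)
  from Assign.prems show ?case by (auto elim: AssignE)
next
  case (Write e s a r)
  from Write.prems show ?case by (auto elim: WriteE)
next
  case (Seq c1 s t1 s1 c2 t2 s2)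
  from Seq.prems obtain u1 q1 u2
    where "exec w c1 s u1 q1" "exec w c2 q1 u2 s''" "t' = u1 + u2"
    by (auto elim: SeqE)
  with Seq.IH show ?case by metis
next
  case (CondTrue b s c1 t s1 c2)
  from CondTrue.prems CondTrue.hyps obtain u where "exec w c1 s u s''" "t' = 1 + u"
    by (auto elim: CondE)
  with CondTrue.IH show ?case by metis
next
  case (CondFalse b s c2 t s1 c1)
  from CondFalse.prems CondFalse.hyps obtain u where "exec w c2 s u s''" "t' = 1 + u"
    by (auto elim: CondE)
  with CondFalse.IH show ?case by metis
next
  case (WhileFalse b s c)
  from WhileFalse.prems WhileFalse.hyps show ?case by (auto elim: WhileE)
next
  case (WhileTrue b s c t1 s1 t2 s2)
  from WhileTrue.prems \<open>test_val b s\<close> obtain u1 q1 u2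
    where "exec w c s u1 q1" "exec w (While b c) q1 u2 s''" "t' = 1 + u1 + u2"
    by (auto elim: WhileE)
  with WhileTrue.IH show ?case by metis
qed

section \<open>Input encoding\<close>

text \<open>
  A graph on the vertices \<open>0, \<dots>, n - 1\<close> is given to a program by \<open>n\<close> and a list of its edges, in
  arbitrary order and with the ends of each edge in arbitrary order.
\<close>

definition edge_listing :: "'a graph \<Rightarrow> ('a \<times> 'a) list \<Rightarrow> bool" where
  "edge_listing G es \<longleftrightarrow>
     distinct (map (\<lambda>(u, v). {u, v}) es) \<and> set (map (\<lambda>(u, v). {u, v}) es) = edges G"

definition input_state :: "nat \<Rightarrow> (nat \<times> nat) list \<Rightarrow> state" where
  "input_state n es = State
     (\<lambda>r. if r = 0 then n else 0)
     (\<lambda>a i. if i < length es \<and> a = 0 then fst (es ! i)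
            else if i < length es \<and> a = 1 then snd (es ! i)
            else 0)"

definition result_of :: "state \<Rightarrow> nat" where
  "result_of s = regs s 0"

text \<open>
  \<open>p\<close> computes the graph invariant \<open>f\<close> on all trees, in time at most \<open>T n\<close> on trees with \<open>n\<close>
  vertices, using words of \<open>O(log n)\<close> bits.
\<close>

definition computes_on_trees :: "com \<Rightarrow> (nat graph \<Rightarrow> nat) \<Rightarrow> (nat \<Rightarrow> nat) \<Rightarrow> bool" where
  "computes_on_trees p f T \<longleftrightarrow>
     (\<exists>d. \<forall>n G es. is_tree G \<and> verts G = {..<n} \<and> edge_listing G es \<longrightarrow>
        (\<exists>t s. exec ((n + 1) ^ d) p (input_state n es) t s \<and> t \<le> T n \<and> result_of s = f G))"

end

theory Submission
  imports Defs
begin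

text \<open>
  A forest edge set that contains a path on five vertices is not a unigraph: switching its two end
  edges keeps all degrees and closes a triangle. Hence a connected unigraph inside a forest has an
  edge meeting all its other edges, i.e. it is a double star (a star being a degenerate case), and
  conversely double stars are determined by their degrees. So the unigraph number of a tree is its
  edge domination number, which the usual greedy strategy finds while removing leaves: a leaf
  without obligation passes on to its neighbour the duty of being covered, and a leaf that must
  be covered forces the choice of its only edge.
\<close>

section \<open>Forests\<close>

text \<open>Deleting the edge at a leaf leaves an isolated vertex and obligations behind, so the
  argument cannot stay with trees. It is carried out for forests given by edge sets and for the
  labelled quantity \<open>cover_number E l\<close>, whose case of all labels 0 is the unigraph
  number; for each label of a leaf there is an exact equation between its values before and after
  the deletion. Linear time rests on two observations. Deleting a leaf changes the degree of only
  one other vertex, so new leaves are found at that neighbour, without a queue, and every loop step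
  deletes an edge or advances a scan of the vertices. And no adjacency lists are built: the sum of
  the neighbours of a vertex is maintained by one addition or subtraction per edge end, and for a
  leaf it is the neighbour itself. These sums determine the word size.\<close>

definition nbrs :: "'a set set \<Rightarrow> 'a \<Rightarrow> 'a set" where
  "nbrs E v = {u. {v, u} \<in> E}"

text \<open>An edge set without connectivity gives a class closed under subsets
  (\<open>forest_subset\<close>), so colour classes and the remainders after deletions stay in
  it.\<close>

definition forest :: "'a set set \<Rightarrow> bool" where
  "forest E \<longleftrightarrow> finite E \<and> (\<forall>e\<in>E. card e = 2) \<and> (\<nexists>p. is_cycle (edge_induced E) p)"

lemma edge_induced_sel [simp]: "verts (edge_induced F) = \<Union>F" "edges (edge_induced F) = F"
  by (simp_all add: edge_induced_def)

lemma is_cycle_mono: "is_cycle G p \<Longrightarrow> edges G \<subseteq> edges H \<Longrightarrow> is_cycle H p"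
  unfolding is_cycle_def by blast

lemma forest_subset: "forest E \<Longrightarrow> F \<subseteq> E \<Longrightarrow> forest F"
  unfolding forest_def using is_cycle_mono[of "edge_induced F" _ "edge_induced E"]
  by (auto intro: finite_subset)

lemma card_2_memE:
  assumes "card e = 2" "x \<in> e"
  obtains y where "e = {x, y}" "x \<noteq> y"
  using assms by (auto simp: card_2_iff)

lemma forest_edge_neq: "forest E \<Longrightarrow> {a, b} \<in> E \<Longrightarrow> a \<noteq> b"
  unfolding forest_def by force

lemma forest_edgeE:
  assumes "forest E" "e \<in> E" "x \<in> e"
  obtains y where "e = {x, y}" "x \<noteq> y"
  using assms card_2_memE unfolding forest_def by metis

lemma forest_finite_Union: "forest E \<Longrightarrow> finite (\<Union>E)"
  unfolding forest_def by (metis card.infinite finite_Union zero_neq_numeral)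

lemma simple_graph_edge_induced: "forest F \<Longrightarrow> simple_graph (edge_induced F)"
  unfolding simple_graph_def using forest_finite_Union by (auto simp: forest_def)

lemma tree_forest: "is_tree G \<Longrightarrow> forest (edges G)"
proof -
  assume G: "is_tree G"
  hence "edges G \<subseteq> Pow (verts G)" "finite (verts G)"
    by (auto simp: is_tree_def simple_graph_def)
  hence "finite (edges G)" by (meson finite_Pow_iff finite_subset)
  thus ?thesis using G is_cycle_mono[of "edge_induced (edges G)" _ G]
    by (auto simp: forest_def is_tree_def simple_graph_def)
qed

lemma forest_no_triangle:
  assumes "forest E" "{a, b} \<in> E" "{b, c} \<in> E" "{c, a} \<in> E"
  shows False
proof -
  have "is_cycle (edge_induced E) [a, b, c]"
    using assms forest_edge_neq[OF assms(1)] by (auto simp: is_cycle_def All_less_Suc)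
  thus False using assms(1) by (auto simp: forest_def)
qed

lemma forest_no_4_cycle:
  assumes "forest E" "{a, b} \<in> E" "{b, c} \<in> E" "{c, d} \<in> E" "{d, a} \<in> E" "a \<noteq> c" "b \<noteq> d"
  shows False
proof -
  have "is_cycle (edge_induced E) [a, b, c, d]"
    using assms forest_edge_neq[OF assms(1)]
    by (auto simp: is_cycle_def All_less_Suc)
  thus False using assms(1) by (auto simp: forest_def)
qed

lemma forest_no_5_cycle:
  assumes "forest E" "{a, b} \<in> E" "{b, c} \<in> E" "{c, d} \<in> E" "{d, e} \<in> E" "{e, a} \<in> E"
    and "distinct [a, b, c, d, e]"
  shows False
proof -
  have "is_cycle (edge_induced E) [a, b, c, d, e]"
    using assms by (auto simp: is_cycle_def All_less_Suc)
  thus False using assms(1) by (auto simp: forest_def)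
qed

text \<open>The first vertex of a longest path is a leaf.\<close>

lemma forest_leaf:
  assumes E: "forest E" and ne: "E \<noteq> {}"
  shows "\<exists>x y. nbrs E x = {y}"
proof -
  define P where "P p \<longleftrightarrow> length p \<ge> 2 \<and> distinct p \<and>
    (\<forall>i. Suc i < length p \<longrightarrow> {p ! i, p ! Suc i} \<in> E)" for p
  obtain a b where "{a, b} \<in> E" "a \<noteq> b"
    using E ne by (metis card_2_iff ex_in_conv forest_def)
  hence "P [a, b]" by (auto simp: P_def)
  moreover have "length p \<le> card (\<Union>E)" if "P p" for p
  proof -
    have "p ! i \<in> \<Union>E" if i: "i < length p" for i
    proof (cases "Suc i < length p")
      case True thus ?thesis using \<open>P p\<close> by (auto simp: P_def)
    next
      case False
      hence "Suc (i - 1) = i" using \<open>P p\<close> i unfolding P_def by linarith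
      hence "{p ! (i - 1), p ! i} \<in> E" using \<open>P p\<close> i unfolding P_def by metis
      thus ?thesis by auto
    qed
    hence "set p \<subseteq> \<Union>E" by (metis in_set_conv_nth subsetI)
    hence "card (set p) \<le> card (\<Union>E)" using card_mono[OF forest_finite_Union[OF E]] by blast
    moreover have "distinct p" using \<open>P p\<close> by (simp add: P_def)
    ultimately show ?thesis by (simp add: distinct_card)
  qed
  ultimately have "\<exists>p. P p \<and> (\<forall>q. P q \<longrightarrow> length q \<le> length p)"
    by (intro ex_has_greatest_nat[of P _ length "Suc (card (\<Union>E))"]) (auto simp: less_Suc_eq_le)
  then obtain p where p: "P p" and max: "\<And>q. P q \<Longrightarrow> length q \<le> length p" by blast
  have "length p \<ge> 2" using p by (simp add: P_def)
  then obtain x y r where r: "p = x # y # r" by (cases p; cases "tl p") auto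
  have "{p ! 0, p ! Suc 0} \<in> E" using p r unfolding P_def by force
  hence xy: "{x, y} \<in> E" using r by simp
  \<comment> \<open>A second neighbour \<open>z\<close> of the end \<open>x\<close> would either
    prolong the longest path or, being at position \<open>j \<ge> 2\<close> on it, close a cycle
    with the first \<open>j + 1\<close> vertices.\<close>
  have "z = y" if z: "{x, z} \<in> E" for z
  proof (rule ccontr)
    assume "z \<noteq> y"
    have "x \<noteq> z" using forest_edge_neq E z by metis
    show False
    proof (cases "z \<in> set p")
      case False
      have "P (z # p)" unfolding P_def
      proof (intro conjI allI impI)
        show "2 \<le> length (z # p)" "distinct (z # p)" using False p by (auto simp: P_def)
        fix i assume "Suc i < length (z # p)"
        thus "{(z # p) ! i, (z # p) ! Suc i} \<in> E"
          using p z r by (cases i) (auto simp: P_def insert_commute)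
      qed
      from max[OF this] show False by simp
    next
      case True
      then obtain j where j: "j < length p" "p ! j = z" by (auto simp: in_set_conv_nth)
      have "j \<noteq> 0" "j \<noteq> 1" using j(2) r \<open>x \<noteq> z\<close> \<open>z \<noteq> y\<close> by (metis One_nat_def nth_Cons_0 nth_Cons_Suc)+
      hence j2: "j \<ge> 2" by simp
      have "is_cycle (edge_induced E) (take (Suc j) p)" unfolding is_cycle_def
      proof (intro conjI allI impI)
        show "3 \<le> length (take (Suc j) p)" using j j2 by simp
        show "distinct (take (Suc j) p)" using p by (auto simp: P_def)
        fix i assume i: "i < length (take (Suc j) p)"
        show "{take (Suc j) p ! i, take (Suc j) p ! (Suc i mod length (take (Suc j) p))}
            \<in> edges (edge_induced E)"
        proof (cases "i = j")
          case True
          hence "Suc i mod length (take (Suc j) p) = 0" using j by (simp add: min_absorb2)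
          moreover have "take (Suc j) p ! i = z" "take (Suc j) p ! 0 = x"
            using True j r by (simp_all del: take_Suc_Cons)
          ultimately show ?thesis using z by (simp add: insert_commute)
        next
          case False
          hence "i < j" using i j by simp
          hence "Suc i mod length (take (Suc j) p) = Suc i" using j by (simp add: min_absorb2)
          thus ?thesis using \<open>i < j\<close> j p by (auto simp: P_def)
        qed
      qed
      thus False using E by (auto simp: forest_def)
    qed
  qed
  hence "nbrs E x = {y}" using xy unfolding nbrs_def by blast
  thus ?thesis by blast
qed

lemma forest_nbrs_edge:
  assumes "forest E" "nbrs E x = {y}" "e \<in> E" "x \<in> e"
  shows "e = {x, y}"
proof -
  obtain z where "e = {x, z}" using forest_edgeE[OF assms(1,3,4)] by blast
  thus ?thesis using assms(2,3) by (auto simp: nbrs_def)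
qed

text \<open>Deleting the only edge at a leaf \<open>x\<close> takes \<open>x\<close> out of the
  union, so each edge costs at least one vertex. This later bounds the input list and the number of
  deletions by \<open>n\<close>.\<close>

lemma forest_card_le: "forest E \<Longrightarrow> card E \<le> card (\<Union>E)"
proof (induction "card E" arbitrary: E)
  case (Suc k)
  hence "E \<noteq> {}" by auto
  then obtain x y where xy: "nbrs E x = {y}" using forest_leaf Suc.prems by blast
  let ?F = "E - {{x, y}}"
  have in_E: "{x, y} \<in> E" using xy by (auto simp: nbrs_def)
  have fin: "finite (\<Union>E)" using forest_finite_Union Suc.prems by blast
  have cF: "card E = Suc (card ?F)"
    using in_E Suc.prems by (metis card_Suc_Diff1 forest_def)
  have "card ?F \<le> card (\<Union>?F)"
    using Suc.hyps cF forest_subset[OF Suc.prems] by auto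
  also have "\<dots> < card (\<Union>E)"
  proof (rule psubset_card_mono[OF fin])
    have "x \<notin> \<Union>?F" using forest_nbrs_edge[OF Suc.prems xy] by blast
    thus "\<Union>?F \<subset> \<Union>E" using in_E by blast
  qed
  finally show ?case using cF by simp
qed simp

lemma nbrs_subset: "nbrs E v \<subseteq> \<Union>E"
  by (auto simp: nbrs_def)

lemma degree_eq_card_nbrs:
  assumes "\<forall>e\<in>edges G. card e = 2"
  shows "degree G v = card (nbrs (edges G) v)"
proof -
  have "\<exists>u. e = {v, u}" if "e \<in> edges G" "v \<in> e" for e
    using assms that card_2_memE by metis
  hence "{e \<in> edges G. v \<in> e} = (\<lambda>u. {v, u}) ` nbrs (edges G) v"
    by (fastforce simp: nbrs_def)
  moreover have "inj_on (\<lambda>u. {v, u}) (nbrs (edges G) v)"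
    by (auto simp: inj_on_def doubleton_eq_iff)
  ultimately show ?thesis unfolding degree_def by (simp add: card_image)
qed

section \<open>Unigraphic trees are double stars\<close>

text \<open>Acyclicity acts twice: it keeps both new edges out of \<open>F\<close>, so that the
  switch preserves degrees, and it denies \<open>F\<close> an image of the triangle
  \<open>b\<close>, \<open>c\<close>, \<open>d\<close>.\<close>

lemma path5_not_unigraph:
  assumes F: "forest F" and ab: "{a, b} \<in> F" and bc: "{b, c} \<in> F" and cd: "{c, d} \<in> F"
    and de: "{d, e} \<in> F" and dist: "distinct [a, b, c, d, e]"
  shows "\<not> unigraph (edge_induced F)"
proof
  assume U: "unigraph (edge_induced F)"
  let ?H = "Graph (\<Union>F) (F - {{a, b}, {d, e}} \<union> {{b, d}, {a, e}})"
  have fin: "finite F" using F by (simp add: forest_def)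
  have bd: "{b, d} \<notin> F" using forest_no_triangle[OF F bc cd] by (metis insert_commute)
  have ae: "{a, e} \<notin> F"
    using forest_no_5_cycle[OF F ab bc cd de _ dist] by (metis insert_commute)
  \<comment> \<open>At each of the four switched vertices one deleted edge \<open>x\<close> is
    exchanged for one added edge \<open>y\<close>, and the other two edges miss
    \<open>v\<close>.\<close>
  have swap: "card {f \<in> F - {x, x'} \<union> {y, y'}. v \<in> f} = card {f \<in> F. v \<in> f}"
    if "x \<in> F" "y \<notin> F" "v \<in> x" "v \<in> y" "v \<notin> x'" "v \<notin> y'" for v x x' y y'
  proof -
    have "{f \<in> F - {x, x'} \<union> {y, y'}. v \<in> f} = insert y ({f \<in> F. v \<in> f} - {x})"
      using that by auto
    moreover have "card (insert y ({f \<in> F. v \<in> f} - {x})) = card {f \<in> F. v \<in> f}"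
      using that fin card_Suc_Diff1[of "{f \<in> F. v \<in> f}" x] by simp
    ultimately show ?thesis by simp
  qed
  have dist': "b \<noteq> a" "d \<noteq> a" "d \<noteq> b" "e \<noteq> a" "e \<noteq> b" "e \<noteq> d" using dist by auto
  have deg: "degree ?H v = degree (edge_induced F) v" for v
  proof -
    consider "v = a" | "v = b" | "v = d" | "v = e" | "v \<notin> {a, b, d, e}" by blast
    hence "card {f \<in> F - {{a, b}, {d, e}} \<union> {{b, d}, {a, e}}. v \<in> f} = card {f \<in> F. v \<in> f}"
    proof cases
      case 1
      thus ?thesis using swap[of "{a, b}" "{a, e}" v "{d, e}" "{b, d}"] ab ae dist dist'
        by (simp add: insert_commute)
    next
      case 2
      thus ?thesis using swap[of "{a, b}" "{b, d}" v "{d, e}" "{a, e}"] ab bd dist dist' by simp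
    next
      case 3
      thus ?thesis using swap[of "{d, e}" "{b, d}" v "{a, b}" "{a, e}"] de bd dist dist'
        by (simp add: insert_commute)
    next
      case 4
      thus ?thesis using swap[of "{d, e}" "{a, e}" v "{a, b}" "{b, d}"] de ae dist dist'
        by (simp add: insert_commute)
    next
      case 5
      hence "{f \<in> F - {{a, b}, {d, e}} \<union> {{b, d}, {a, e}}. v \<in> f} = {f \<in> F. v \<in> f}" by blast
      thus ?thesis by simp
    qed
    thus ?thesis by (simp add: degree_def)
  qed
  have "simple_graph ?H"
    using simple_graph_edge_induced[OF F] ab bc cd de dist unfolding simple_graph_def
    by auto
  moreover have "degree_mset ?H = degree_mset (edge_induced F)"
  proof -
    have "degree ?H = degree (edge_induced F)" using deg by blast
    thus ?thesis by (simp add: degree_mset_def)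
  qed
  ultimately have "graph_iso ?H (edge_induced F)" using U by (auto simp: unigraph_def)
  then obtain f where f: "\<forall>s\<in>\<Union>F. \<forall>t\<in>\<Union>F. {s, t} \<in> edges ?H \<longleftrightarrow> {f s, f t} \<in> F"
    unfolding graph_iso_def graph.sel edge_induced_sel by blast
  have "b \<in> \<Union>F" "c \<in> \<Union>F" "d \<in> \<Union>F" using ab bc cd by auto
  moreover have "{b, c} \<in> edges ?H" "{c, d} \<in> edges ?H" "{d, b} \<in> edges ?H"
    using bc cd dist dist' by (auto simp: doubleton_eq_iff insert_commute)
  ultimately have "{f b, f c} \<in> F" "{f c, f d} \<in> F" "{f d, f b} \<in> F" using f by blast+
  thus False using forest_no_triangle[OF F] by blast
qed

lemma undominated_edge_nearby:
  assumes F: "forest F" and con: "connected_graph (edge_induced F)" and uv: "{u, v} \<in> F"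
    and g: "g \<in> F" "{u, v} \<inter> g = {}"
  shows "\<exists>p q r. {p, q} \<in> F \<and> {p, q} \<inter> {u, v} = {} \<and> r \<in> {u, v} \<and> {r, p} \<in> F"
proof (rule ccontr)
  assume no: "\<not> ?thesis"
  \<comment> \<open>If the claim fails, this closed neighbourhood is closed under adjacency and
    hence contains the end \<open>p\<close> of \<open>g\<close>; but then \<open>g\<close> itself
    has the required form.\<close>
  let ?S = "{u, v} \<union> nbrs F u \<union> nbrs F v"
  have S: "x \<in> ?S" if "(u, x) \<in> {(x, y). {x, y} \<in> edges (edge_induced F)}\<^sup>*" for x
    using that
  proof (induction rule: rtrancl_induct)
    case (step y z)
    show ?case
    proof (cases "y \<in> {u, v}")
      case True thus ?thesis using step.hyps(2) by (auto simp: nbrs_def)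
    next
      case False
      then obtain r where "r \<in> {u, v}" "{r, y} \<in> F" using step.IH by (auto simp: nbrs_def)
      hence "{y, z} \<inter> {u, v} \<noteq> {}" using no step.hyps(2) by auto
      thus ?thesis using False by auto
    qed
  qed simp
  have "g \<noteq> {}" using F g by (auto simp: forest_def)
  then obtain p q where pq: "g = {p, q}" using forest_edgeE[OF F g(1)] by blast
  have "p \<in> \<Union>F" "u \<in> \<Union>F" using g(1) pq uv by auto
  hence "p \<in> ?S" using con unfolding connected_graph_def edge_induced_sel(1) by (intro S) blast
  then obtain r where "r \<in> {u, v}" "{r, p} \<in> F" using g(2) pq by (auto simp: nbrs_def)
  moreover have "{p, q} \<in> F" "{p, q} \<inter> {u, v} = {}" using g pq by (simp_all add: Int_commute)
  ultimately show False using no by blast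
qed

text \<open>Were no edge dominating, there would be a path \<open>s\<close>, \<open>r\<close>,
  \<open>p\<close>, \<open>q\<close>, and an edge missed by its middle edge \<open>{p, r}\<close>
  would extend \<open>r, p, q\<close> or \<open>p, r, s\<close> by two vertices to a path on
  five.\<close>

lemma connected_unigraph_dominating_edge:
  assumes F: "forest F" and con: "connected_graph (edge_induced F)"
    and U: "unigraph (edge_induced F)"
  shows "\<exists>e\<in>F. \<forall>f\<in>F. e \<inter> f \<noteq> {}"
proof (rule ccontr)
  assume no: "\<not> ?thesis"
  have near: "\<exists>p q r. {p, q} \<in> F \<and> {p, q} \<inter> {u, v} = {} \<and> r \<in> {u, v} \<and> {r, p} \<in> F"
    if "{u, v} \<in> F" for u v
  proof -
    have "\<forall>e\<in>F. \<exists>f\<in>F. e \<inter> f = {}" using no by simp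
    hence "\<exists>g\<in>F. {u, v} \<inter> g = {}" using that by (rule bspec)
    then obtain g where "g \<in> F" "{u, v} \<inter> g = {}" by blast
    thus ?thesis by (rule undominated_edge_nearby[OF F con that])
  qed
  have neq: "a \<noteq> b" if "{a, b} \<in> F" for a b
    using forest_edge_neq[OF F that] .
  have "F \<noteq> {}" using con by (auto simp: connected_graph_def)
  then obtain u v where uv: "{u, v} \<in> F"
    using F by (metis card_2_iff ex_in_conv forest_def)
  obtain p q r where 1: "{p, q} \<in> F" "{p, q} \<inter> {u, v} = {}" "r \<in> {u, v}" "{r, p} \<in> F"
    using near[OF uv] by blast
  obtain s where s: "{r, s} \<in> F" "{p, q} \<inter> {r, s} = {}"
    using 1 uv by (intro that[of "if r = u then v else u"]) (auto simp: insert_commute)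
  have pr: "{p, r} \<in> F" using 1(4) by (simp add: insert_commute)
  obtain p' q' r' where 2: "{p', q'} \<in> F" "{p', q'} \<inter> {p, r} = {}" "r' \<in> {p, r}" "{r', p'} \<in> F"
    using near[OF pr] by blast
  have path: False if "{a, b} \<in> F" "{b, c} \<in> F" "{c, d} \<in> F" "{d, e} \<in> F"
      "a \<notin> {c, d}" "b \<noteq> d" "e \<notin> {b, c}" for a b c d e
  proof -
    have "a \<noteq> e" using forest_no_4_cycle[OF F that(1-3)] that(4-6) by blast
    hence "distinct [a, b, c, d, e]" using that(5-7) that(1-4)[THEN neq] by auto
    thus False using path5_not_unigraph[OF F that(1-4)] U by blast
  qed
  show False
  proof (cases "r' = r")
    case True
    hence "{p', r} \<in> F" using 2(4) by (simp add: insert_commute)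
    moreover have "{q', p'} \<in> F" using 2(1) by (simp add: insert_commute)
    moreover have "p' \<noteq> q"
      using forest_no_triangle[OF F 1(4) 1(1)] \<open>{p', r} \<in> F\<close> by blast
    ultimately show False using path[of q' p' r p q] 1(1,4) 2(2) s(2) by auto
  next
    case False
    hence "r' = p" using 2(3) by auto
    hence "{p', p} \<in> F" using 2(4) by (simp add: insert_commute)
    moreover have "{q', p'} \<in> F" using 2(1) by (simp add: insert_commute)
    moreover have "p' \<noteq> s"
      using forest_no_triangle[OF F pr s(1)] \<open>{p', p} \<in> F\<close> by blast
    ultimately show False using path[of q' p' p r s] pr 2(2) s by auto
  qed
qed

section \<open>Double stars are unigraphs\<close>

text \<open>The leaf sets are parameters because isomorphisms are glued from bijections between
  them. Either may be empty.\<close>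

definition double_star :: "'a graph \<Rightarrow> 'a \<Rightarrow> 'a \<Rightarrow> 'a set \<Rightarrow> 'a set \<Rightarrow> bool" where
  "double_star G u v A B \<longleftrightarrow> finite A \<and> finite B \<and> u \<noteq> v \<and> {u, v} \<inter> (A \<union> B) = {} \<and> A \<inter> B = {} \<and>
     verts G = {u, v} \<union> A \<union> B \<and>
     edges G = insert {u, v} ((\<lambda>w. {u, w}) ` A \<union> (\<lambda>w. {v, w}) ` B)"

lemma double_star_edgeE:
  assumes "double_star G u v A B" "e \<in> edges G"
  obtains "e = {u, v}" | w where "w \<in> A" "e = {u, w}" | w where "w \<in> B" "e = {v, w}"
proof -
  have "e \<in> insert {u, v} ((\<lambda>w. {u, w}) ` A \<union> (\<lambda>w. {v, w}) ` B)"
    using assms by (simp add: double_star_def)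
  thus ?thesis using that by (elim insertE UnE imageE) simp_all
qed

lemma double_star_simple:
  assumes G: "double_star G u v A B"
  shows "simple_graph G"
proof -
  have neq: "u \<noteq> v" "w \<in> A \<Longrightarrow> u \<noteq> w" "w \<in> B \<Longrightarrow> v \<noteq> w" for w
    using G by (auto simp: double_star_def)
  have "e \<subseteq> verts G \<and> card e = 2" if "e \<in> edges G" for e
    using G that
  proof (cases rule: double_star_edgeE)
    case 1
    thus ?thesis using G neq by (simp add: double_star_def)
  next
    case (2 w)
    thus ?thesis using G neq(2)[of w] by (simp add: double_star_def)
  next
    case (3 w)
    thus ?thesis using G neq(3)[of w] by (simp add: double_star_def)
  qed
  thus ?thesis using G by (simp add: simple_graph_def double_star_def)
qed

lemma double_star_degree:
  assumes "double_star G u v A B"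
  shows "degree G u = Suc (card A)" "degree G v = Suc (card B)"
    and "w \<in> A \<union> B \<Longrightarrow> degree G w = 1"
proof -
  have deg: "degree G x = card (nbrs (edges G) x)" for x
    using double_star_simple[OF assms] by (simp add: degree_eq_card_nbrs simple_graph_def)
  have "nbrs (edges G) u = insert v A" "nbrs (edges G) v = insert u B"
    using assms by (auto simp: double_star_def nbrs_def doubleton_eq_iff)
  thus "degree G u = Suc (card A)" "degree G v = Suc (card B)"
    using assms by (auto simp: deg double_star_def)
  assume "w \<in> A \<union> B"
  hence "nbrs (edges G) w = {if w \<in> A then u else v}"
    using assms by (auto simp: double_star_def nbrs_def doubleton_eq_iff)
  thus "degree G w = 1" by (simp add: deg)
qed

lemma double_star_degree_mset:
  assumes "double_star G u v A B"
  shows "degree_mset G =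
    add_mset (Suc (card A)) (add_mset (Suc (card B)) (replicate_mset (card A + card B) 1))"
proof -
  have G: "finite A" "finite B" "A \<inter> B = {}" "u \<noteq> v" "{u, v} \<inter> (A \<union> B) = {}"
    "verts G = insert u (insert v (A \<union> B))"
    using assms by (auto simp: double_star_def)
  have "image_mset (degree G) (mset_set (A \<union> B)) = image_mset (\<lambda>_. 1) (mset_set (A \<union> B))"
    using double_star_degree(3)[OF assms] G by (intro image_mset_cong) auto
  also have "\<dots> = replicate_mset (card A + card B) 1"
    using G by (simp add: image_mset_const_eq card_Un_disjoint)
  finally show ?thesis using G double_star_degree(1,2)[OF assms]
    by (simp add: degree_mset_def)
qed

lemma double_star_connected:
  assumes "double_star G u v A B"
  shows "connected_graph G"
proof -
  let ?R = "{(x, y). {x, y} \<in> edges G}"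
  have R: "(x, y) \<in> ?R\<^sup>*" "(y, x) \<in> ?R\<^sup>*" if "{x, y} \<in> edges G" for x y
    by (rule r_into_rtrancl, use that in \<open>simp add: insert_commute\<close>)+
  have E: "{u, v} \<in> edges G" "\<And>w. w \<in> A \<Longrightarrow> {u, w} \<in> edges G" "\<And>w. w \<in> B \<Longrightarrow> {v, w} \<in> edges G"
    using assms by (simp_all add: double_star_def)
  have "(w, u) \<in> ?R\<^sup>* \<and> (u, w) \<in> ?R\<^sup>*" if "w \<in> verts G" for w
  proof -
    consider "w = u" | "w = v" | "w \<in> A" | "w \<in> B" using assms \<open>w \<in> verts G\<close> unfolding double_star_def by blast
    thus ?thesis
    proof cases
      case 1 thus ?thesis by simp
    next
      case 2 thus ?thesis using R E(1) by blast
    next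
      case 3 thus ?thesis using R E(2) by blast
    next
      case 4 thus ?thesis using R[OF E(3)] R[OF E(1)] rtrancl_trans by meson
    qed
  qed
  hence "(x, y) \<in> ?R\<^sup>*" if "x \<in> verts G" "y \<in> verts G" for x y
    using that rtrancl_trans by meson
  thus ?thesis using assms by (simp add: double_star_def connected_graph_def)
qed

lemma double_star_iso:
  assumes G: "double_star G u v A B" and H: "double_star H u' v' A' B'"
    and "card A = card A'" "card B = card B'"
  shows "graph_iso G H"
proof -
  have fin: "finite A" "finite A'" "finite B" "finite B'" and neq: "u \<noteq> v" "u' \<noteq> v'"
    using G H by (simp_all add: double_star_def)
  obtain f g where f: "bij_betw f A A'" and g: "bij_betw g B B'"
    using finite_same_card_bij[OF fin(1,2)] finite_same_card_bij[OF fin(3,4)] assms(3,4) by blast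
  define h where "h w = (if w = u then u' else if w = v then v' else if w \<in> A then f w else g w)" for w
  have hA: "bij_betw h A A'"
    using f G by (subst bij_betw_cong[where g = f]) (auto simp: h_def double_star_def)
  have hB: "bij_betw h B B'"
    using g G by (subst bij_betw_cong[where g = g]) (auto simp: h_def double_star_def)
  have hu: "h u = u'" "h v = v'" using G by (auto simp: h_def double_star_def)
  have huv: "bij_betw h {u, v} {u', v'}"
    using neq hu by (simp add: bij_betw_def)
  have disj: "{u', v'} \<inter> A' = {}" "({u', v'} \<union> A') \<inter> B' = {}"
    using H by (auto simp: double_star_def)
  have bij: "bij_betw h (verts G) (verts H)"
    using bij_betw_combine[OF bij_betw_combine[OF huv hA disj(1)] hB disj(2)] G H
    by (simp add: double_star_def)
  have "(`) h ` edges G = insert {u', v'} ((\<lambda>w. {u', w}) ` (h ` A) \<union> (\<lambda>w. {v', w}) ` (h ` B))"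
    using G hu by (simp add: double_star_def image_Un image_image)
  hence img: "(`) h ` edges G = edges H"
    using hA hB H by (simp add: double_star_def bij_betw_def)
  have sub: "edges G \<subseteq> Pow (verts G)"
    using double_star_simple[OF G] by (auto simp: simple_graph_def)
  \<comment> \<open>An isomorphism must also reflect edges: by injectivity on vertex sets, a pair
    whose image is an edge of \<open>H\<close> is an edge of \<open>G\<close>.\<close>
  have inj: "inj_on ((`) h) (Pow (verts G))"
    using bij by (intro inj_on_image_Pow) (rule bij_betw_imp_inj_on)
  have "{s, t} \<in> edges G \<longleftrightarrow> {h s, h t} \<in> edges H" if "s \<in> verts G" "t \<in> verts G" for s t
    using inj_on_image_mem_iff[OF inj _ sub, of "{s, t}"] that by (simp add: img)
  thus ?thesis using bij unfolding graph_iso_def by blast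
qed

lemma image_mset_set_add_msetD:
  assumes "finite V" "image_mset f (mset_set V) = add_mset k M"
  shows "\<exists>x\<in>V. f x = k \<and> image_mset f (mset_set (V - {x})) = M"
proof -
  have "k \<in># image_mset f (mset_set V)" using assms by simp
  then obtain x where "x \<in> V" "f x = k" using assms(1) by auto
  moreover have "image_mset f (mset_set (V - {x})) = M"
    using assms mset_set.remove[OF assms(1) \<open>x \<in> V\<close>] \<open>f x = k\<close> by simp
  ultimately show ?thesis by blast
qed

text \<open>
  The \<open>a + b\<close> vertices of degree 1 do not suffice for disjoint neighbourhoods of sizes \<open>a + 1\<close>
  and \<open>b + 1\<close>, so the two centres are adjacent.
\<close>

lemma double_star_from_degrees:
  assumes H: "simple_graph H" and u: "u \<in> verts H" and v: "v \<in> verts H" and "u \<noteq> v"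
    and du: "degree H u = Suc a" and dv: "degree H v = Suc b"
    and W: "card (verts H - {u, v}) = a + b" "\<And>w. w \<in> verts H - {u, v} \<Longrightarrow> degree H w = 1"
  shows "\<exists>A B. double_star H u v A B \<and> card A = a \<and> card B = b"
proof -
  let ?N = "nbrs (edges H)"
  let ?W = "verts H - {u, v}"
  let ?A = "?N u - {v}" and ?B = "?N v - {u}"
  have deg: "degree H x = card (?N x)" for x
    using H by (simp add: degree_eq_card_nbrs simple_graph_def)
  have fin: "finite (verts H)" using H by (simp add: simple_graph_def)
  have N_sub: "?N x \<subseteq> verts H - {x}" for x
    using H by (force simp: nbrs_def simple_graph_def)
  have finN: "finite (?N x)" for x using N_sub fin finite_subset by (metis finite_Diff)
  have sym: "x \<in> ?N y \<longleftrightarrow> y \<in> ?N x" for x y by (auto simp: nbrs_def insert_commute)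
  have one: "y = z" if "w \<in> ?W" "y \<in> ?N w" "z \<in> ?N w" for w y z
    using W(2)[OF that(1)] that(2,3) unfolding deg by (auto simp: card_1_singleton_iff)
  have AB: "?A \<union> ?B \<subseteq> ?W" using N_sub by fastforce
  have disj: "?A \<inter> ?B = {}"
  proof (rule ccontr)
    assume "?A \<inter> ?B \<noteq> {}"
    then obtain w where w: "w \<in> ?A" "w \<in> ?B" by blast
    hence "w \<in> ?W" using AB by blast
    thus False using one[of w u v] w sym \<open>u \<noteq> v\<close> by blast
  qed
  have cAB: "card ?A + card ?B = card (?A \<union> ?B)"
    using disj finN by (simp add: card_Un_disjoint)
  have vu: "v \<in> ?N u"
  proof (rule ccontr)
    assume "v \<notin> ?N u"
    hence "?A = ?N u" "?B = ?N v" using sym by blast+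
    hence "card ?A + card ?B = a + b + 2" using du dv deg by simp
    thus False using cAB card_mono[OF _ AB] fin W(1) by simp
  qed
  have cA: "card ?A = a" "card ?B = b"
    using vu sym finN du dv deg by (auto simp: card_Diff_singleton)
  have eq: "?A \<union> ?B = ?W"
    using cAB cA W(1) AB fin by (intro card_subset_eq) auto
  have "e \<in> insert {u, v} ((\<lambda>w. {u, w}) ` ?A \<union> (\<lambda>w. {v, w}) ` ?B)" if e: "e \<in> edges H" for e
  proof -
    have c: "card e = 2" "e \<subseteq> verts H" using H e by (auto simp: simple_graph_def)
    consider "u \<in> e" | "v \<in> e" | "e \<subseteq> ?W" using c by blast
    thus ?thesis
    proof cases
      case 1
      then obtain w where "e = {u, w}" using c card_2_memE by metis
      thus ?thesis using e by (auto simp: nbrs_def)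
    next
      case 2
      then obtain w where "e = {v, w}" using c card_2_memE by metis
      thus ?thesis using e by (auto simp: nbrs_def insert_commute)
    next
      case 3
      \<comment> \<open>An edge between two outer vertices would give \<open>s\<close> a second
        neighbour, since \<open>?A \<union> ?B = ?W\<close> already attaches it to a centre.\<close>
      obtain s t where st: "e = {s, t}" using c by (auto simp: card_2_iff)
      hence "t \<in> ?N s" "s \<in> ?W" "t \<in> ?W" using e 3 by (auto simp: nbrs_def)
      moreover have "u \<in> ?N s \<or> v \<in> ?N s" using eq \<open>s \<in> ?W\<close> sym by blast
      ultimately show ?thesis using one by blast
    qed
  qed
  moreover have "insert {u, v} ((\<lambda>w. {u, w}) ` ?A \<union> (\<lambda>w. {v, w}) ` ?B) \<subseteq> edges H"
    using vu by (auto simp: nbrs_def)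
  ultimately have "edges H = insert {u, v} ((\<lambda>w. {u, w}) ` ?A \<union> (\<lambda>w. {v, w}) ` ?B)" by blast
  hence "double_star H u v ?A ?B"
    unfolding double_star_def using eq AB disj finN \<open>u \<noteq> v\<close> u v by auto
  thus ?thesis using cA by blast
qed

text \<open>Two vertices with the degrees of the centres are split off the degree multiset of
  \<open>H\<close>. They need not be unique, as a centre may have degree 1, but
  \<open>double_star_from_degrees\<close> accepts any choice, in a graph \<open>H\<close> that may a
  priori be disconnected or contain cycles.\<close>

lemma double_star_unigraph:
  fixes G :: "'a graph"
  assumes G: "double_star G u v A B"
  shows "unigraph G"
  unfolding unigraph_def
proof (intro conjI allI impI)
  show "simple_graph G" using double_star_simple G .
  fix H :: "'a graph" assume H: "simple_graph H \<and> degree_mset H = degree_mset G"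
  hence fin: "finite (verts H)" by (simp add: simple_graph_def)
  have "image_mset (degree H) (mset_set (verts H)) =
    add_mset (Suc (card A)) (add_mset (Suc (card B)) (replicate_mset (card A + card B) 1))"
    using H double_star_degree_mset[OF G] by (simp add: degree_mset_def)
  from image_mset_set_add_msetD[OF fin this] obtain u' where u': "u' \<in> verts H" "degree H u' = Suc (card A)"
      "image_mset (degree H) (mset_set (verts H - {u'})) =
       add_mset (Suc (card B)) (replicate_mset (card A + card B) 1)"
    by blast
  from image_mset_set_add_msetD[OF _ this(3)] fin obtain v' where v': "v' \<in> verts H - {u'}" "degree H v' = Suc (card B)"
      "image_mset (degree H) (mset_set (verts H - {u'} - {v'})) = replicate_mset (card A + card B) 1"
    by blast
  let ?W = "verts H - {u', v'}"
  have W: "image_mset (degree H) (mset_set ?W) = replicate_mset (card A + card B) 1"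
    using v'(3) by (simp add: Diff_insert2[symmetric] insert_commute)
  have "card ?W = card A + card B" using arg_cong[OF W, of size] by simp
  moreover have "degree H w = 1" if "w \<in> ?W" for w
  proof -
    have "degree H w \<in># image_mset (degree H) (mset_set ?W)" using that fin by simp
    thus ?thesis unfolding W by (simp split: if_splits)
  qed
  ultimately obtain A' B' where "double_star H u' v' A' B'" "card A' = card A" "card B' = card B"
    using double_star_from_degrees[of H u' v'] H u' v' by blast
  thus "graph_iso H G" by (rule double_star_iso[OF _ G])
qed

lemma dominating_edge_double_star:
  assumes F: "forest F" and uv: "{u, v} \<in> F" and dom: "\<forall>f\<in>F. {u, v} \<inter> f \<noteq> {}"
  shows "double_star (edge_induced F) u v (nbrs F u - {v}) (nbrs F v - {u})"
proof -
  have neq: "a \<noteq> b" if "{a, b} \<in> F" for a b using forest_edge_neq[OF F that] .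
  have edge: "e \<in> insert {u, v} ((\<lambda>w. {u, w}) ` (nbrs F u - {v}) \<union> (\<lambda>w. {v, w}) ` (nbrs F v - {u}))"
    if e: "e \<in> F" for e
  proof -
    have "u \<in> e \<or> v \<in> e" using dom e by blast
    then obtain w where "e = {u, w} \<or> e = {v, w}" using forest_edgeE[OF F e] by metis
    thus ?thesis using e by (auto simp: nbrs_def insert_commute)
  qed
  hence F_eq: "F = insert {u, v} ((\<lambda>w. {u, w}) ` (nbrs F u - {v}) \<union> (\<lambda>w. {v, w}) ` (nbrs F v - {u}))"
    using uv by (auto simp: nbrs_def)
  have "\<Union>F = {u, v} \<union> (nbrs F u - {v}) \<union> (nbrs F v - {u})"
    by (subst F_eq) auto
  moreover have "(nbrs F u - {v}) \<inter> (nbrs F v - {u}) = {}"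
    using forest_no_triangle[OF F uv] by (auto simp: nbrs_def insert_commute)
  moreover have "u \<notin> nbrs F u" "v \<notin> nbrs F v" using neq[of u u] neq[of v v] by (auto simp: nbrs_def)
  moreover have "finite (nbrs F w)" for w
    using finite_subset[OF nbrs_subset forest_finite_Union[OF F]] .
  ultimately show ?thesis unfolding double_star_def edge_induced_sel
    using neq[OF uv] by (intro conjI F_eq) simp_all
qed

section \<open>Unigraph number and edge domination\<close>

text \<open>
  A vertex labelled 1 has to be covered, a vertex labelled 2 counts as covered already. Admitting
  singletons besides edges lets the residual problem after deleting edges still cover a vertex
  that has lost all its edges.
\<close>

definition cover :: "'a set set \<Rightarrow> ('a \<Rightarrow> nat) \<Rightarrow> 'a set set \<Rightarrow> bool" where
  "cover E l D \<longleftrightarrow> finite D \<and> D \<subseteq> E \<union> range (\<lambda>v. {v}) \<and> (\<forall>v. l v = 1 \<longrightarrow> v \<in> \<Union>D) \<and>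
     (\<forall>e\<in>E. \<exists>v\<in>e. l v = 2 \<or> v \<in> \<Union>D)"

text \<open>With \<open>\<le>\<close> the admissible \<open>k\<close> are upward closed, so
  equations between cover numbers reduce to equivalences of thresholds, without covers of exact
  size.\<close>

definition cover_number :: "'a set set \<Rightarrow> ('a \<Rightarrow> nat) \<Rightarrow> nat" where
  "cover_number E l = (LEAST k. \<exists>D. cover E l D \<and> card D \<le> k)"

text \<open>One dominating edge is taken from each colour class; together they meet all edges, which
  is all that a cover has to do when every label is 0.\<close>

lemma coloring_imp_cover:
  assumes G: "forest (edges G)" and c: "unigraphic_coloring G k c"
  shows "\<exists>D. cover (edges G) (\<lambda>_. 0) D \<and> card D \<le> k"
proof -
  let ?F = "\<lambda>i. {e \<in> edges G. c e = i}"
  have "\<forall>i\<in>{1..k}. \<exists>e. e \<in> ?F i \<and> (\<forall>f\<in>?F i. e \<inter> f \<noteq> {})"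
  proof
    fix i assume "i \<in> {1..k}"
    hence "connected_graph (edge_induced (?F i))" "unigraph (edge_induced (?F i))"
      using c by (simp_all add: unigraphic_coloring_def color_subgraph_def)
    moreover have "forest (?F i)" using forest_subset[OF G] by auto
    ultimately have "\<exists>e\<in>?F i. \<forall>f\<in>?F i. e \<inter> f \<noteq> {}"
      by (intro connected_unigraph_dominating_edge)
    thus "\<exists>e. e \<in> ?F i \<and> (\<forall>f\<in>?F i. e \<inter> f \<noteq> {})"
      unfolding Bex_def .
  qed
  from bchoice[OF this] obtain d
    where d: "\<And>i. i \<in> {1..k} \<Longrightarrow> d i \<in> ?F i \<and> (\<forall>f\<in>?F i. d i \<inter> f \<noteq> {})"
    by blast
  have "\<exists>v\<in>e. v \<in> \<Union>(d ` {1..k})" if "e \<in> edges G" for e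
  proof -
    have "c e \<in> {1..k}" using c that by (simp add: unigraphic_coloring_def)
    thus ?thesis using d[of "c e"] that by blast
  qed
  hence "cover (edges G) (\<lambda>_. 0) (d ` {1..k})"
    using d by (auto simp: cover_def)
  moreover have "card (d ` {1..k}) \<le> k" using card_image_le[of "{1..k}" d] by simp
  ultimately show ?thesis by blast
qed

lemma dominating_set_imp_coloring:
  assumes G: "forest (edges G)" and D: "D \<subseteq> edges G"
    and dom: "\<And>e. e \<in> edges G \<Longrightarrow> \<exists>d\<in>D. d \<inter> e \<noteq> {}"
  shows "\<exists>c. unigraphic_coloring G (card D) c"
proof -
  have "finite D" using G D by (auto simp: forest_def intro: finite_subset)
  then obtain h where h: "bij_betw h D {1..card D}"
    by (metis finite_same_card_bij finite_atLeastAtMost card_atLeastAtMost diff_Suc_1)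
  obtain a where a: "\<And>e. e \<in> edges G \<Longrightarrow> a e \<in> D \<and> a e \<inter> e \<noteq> {}" using dom by metis
  \<comment> \<open>Members of \<open>D\<close> keep their own number, so every colour occurs and
    its class contains just one member of \<open>D\<close>, the central edge of a double
    star.\<close>
  define c where "c e = h (if e \<in> D then e else a e)" for e
  have "c e \<in> {1..card D}" if "e \<in> edges G" for e
    using a that h by (auto simp: c_def bij_betw_def)
  moreover have "connected_graph (color_subgraph G c i) \<and> unigraph (color_subgraph G c i)"
    if "i \<in> {1..card D}" for i
  proof -
    let ?F = "{e \<in> edges G. c e = i}"
    have "i \<in> h ` D" using h that by (simp add: bij_betw_def)
    then obtain d where d: "d \<in> D" "h d = i" by blast
    have F: "forest ?F" using forest_subset[OF G] by auto
    have dF: "d \<in> ?F" using d D by (auto simp: c_def)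
    have ne: "d \<noteq> {}" using F dF by (auto simp: forest_def)
    then obtain u v where uv: "d = {u, v}" using forest_edgeE[OF F dF] by blast
    have "d \<inter> f \<noteq> {}" if f: "f \<in> ?F" for f
    proof (cases "f \<in> D")
      case True
      hence "f = d" using f d h by (auto simp: c_def bij_betw_def inj_on_def)
      thus ?thesis using ne by simp
    next
      case False
      hence "a f = d" using f d h a by (auto simp: c_def bij_betw_def inj_on_def)
      thus ?thesis using a f by auto
    qed
    hence ds: "double_star (edge_induced ?F) u v (nbrs ?F u - {v}) (nbrs ?F v - {u})"
      using dominating_edge_double_star[OF F] dF uv by auto
    show ?thesis unfolding color_subgraph_def
      using double_star_connected[OF ds] double_star_unigraph[OF ds] by blast
  qed
  ultimately show ?thesis unfolding unigraphic_coloring_def by blast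
qed

lemma cover_imp_coloring:
  assumes G: "forest (edges G)" and D: "cover (edges G) (\<lambda>_. 0) D"
  shows "\<exists>j c. j \<le> card D \<and> unigraphic_coloring G j c"
proof -
  let ?E = "edges G"
  \<comment> \<open>A singleton is enlarged to an edge through its vertex. At an isolated vertex
    \<open>SOME\<close> is arbitrary, hence the intersection with \<open>?E\<close> below.\<close>
  define g where "g d = (if d \<in> ?E then d else SOME e. e \<in> ?E \<and> d \<subseteq> e)" for d
  have g: "g d \<in> ?E \<and> d \<subseteq> g d" if "d \<in> D" "e \<in> ?E" "v \<in> d" "v \<in> e" for d e v
  proof (cases "d \<in> ?E")
    case False
    hence "e \<in> ?E \<and> d \<subseteq> e" using D that by (auto simp: cover_def)
    thus ?thesis using someI[of "\<lambda>e. e \<in> ?E \<and> d \<subseteq> e"] False by (simp add: g_def)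
  qed (simp add: g_def)
  let ?D = "g ` D \<inter> ?E"
  have "\<exists>d\<in>?D. d \<inter> e \<noteq> {}" if "e \<in> ?E" for e
  proof -
    have "\<exists>v\<in>e. v \<in> \<Union>D" using D that by (simp add: cover_def)
    then obtain d v where "d \<in> D" "v \<in> d" "v \<in> e" by blast
    thus ?thesis using g[of d e v] that by blast
  qed
  then obtain c where "unigraphic_coloring G (card ?D) c"
    using dominating_set_imp_coloring[OF G, of ?D] by blast
  moreover have "card ?D \<le> card D"
    using D by (meson card_image_le card_mono cover_def finite_imageI inf_le1 le_trans)
  ultimately show ?thesis by blast
qed

lemma cover_exists:
  assumes "forest E" "finite {v. l v = 1}"
  shows "\<exists>D. cover E l D"
proof -
  have "cover E l (E \<union> (\<lambda>v. {v}) ` {v. l v = 1})"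
    using assms by (fastforce simp: cover_def forest_def card_2_iff)
  thus ?thesis by blast
qed

text \<open>\<open>?Q\<close> is upward closed but \<open>?P\<close> is not, since every colour must
  occur. Hence \<open>?Q k\<close> yields only some \<open>?P j\<close> with
  \<open>j \<le> k\<close>, which is enough for equal minima.\<close>

lemma unigraph_number_eq_cover_number:
  assumes G: "forest (edges G)"
  shows "unigraph_number G = cover_number (edges G) (\<lambda>_. 0)"
proof -
  let ?P = "\<lambda>k. \<exists>c. unigraphic_coloring G k c"
  let ?Q = "\<lambda>k. \<exists>D. cover (edges G) (\<lambda>_. 0) D \<and> card D \<le> k"
  have PQ: "?P k \<Longrightarrow> ?Q k" for k using coloring_imp_cover[OF G] by blast
  have QP: "?Q k \<Longrightarrow> \<exists>j\<le>k. ?P j" for k using cover_imp_coloring[OF G] le_trans by blast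
  have "\<exists>k. ?Q k" using cover_exists[OF G, of "\<lambda>_. 0"] by auto
  then obtain j where "?P j" using QP by blast
  hence P: "?P (Least ?P)" by (rule LeastI)
  have Q: "?Q (Least ?Q)" using PQ[OF P] by (rule LeastI)
  have "Least ?Q \<le> Least ?P" using PQ[OF P] by (rule Least_le)
  moreover obtain i where "i \<le> Least ?Q" "?P i" using QP[OF Q] by blast
  moreover from this(2) have "Least ?P \<le> i" by (rule Least_le)
  ultimately show ?thesis by (simp add: unigraph_number_def cover_number_def)
qed

section \<open>Removing a leaf\<close>

lemma coverI:
  assumes "finite D" "D \<subseteq> E \<union> range (\<lambda>v. {v})" "\<And>v. l v = 1 \<Longrightarrow> v \<in> \<Union>D"
    and "\<And>e. e \<in> E \<Longrightarrow> \<exists>v\<in>e. l v = 2 \<or> v \<in> \<Union>D"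
  shows "cover E l D"
  unfolding cover_def using assms by blast

lemma coverD:
  assumes "cover E l D"
  shows "finite D" "D \<subseteq> E \<union> range (\<lambda>v. {v})" "l v = 1 \<Longrightarrow> v \<in> \<Union>D"
    and "e \<in> E \<Longrightarrow> \<exists>v\<in>e. l v = 2 \<or> v \<in> \<Union>D"
  using assms unfolding cover_def by blast+

lemma cover_number_eqI:
  assumes "\<And>D. cover E l D \<Longrightarrow> \<exists>D'. cover E' l' D' \<and> card D' \<le> card D"
    and "\<And>D. cover E' l' D \<Longrightarrow> cover E l D"
  shows "cover_number E l = cover_number E' l'"
proof -
  have "(\<exists>D. cover E l D \<and> card D \<le> k) = (\<exists>D. cover E' l' D \<and> card D \<le> k)" for k
    using assms le_trans by metis
  thus ?thesis by (simp add: cover_number_def)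
qed

context
  fixes E :: "'a set set" and x y :: 'a
  assumes E: "forest E" and leaf: "nbrs E x = {y}"
begin

lemma leaf_edge: "{x, y} \<in> E" "x \<noteq> y"
proof -
  show "{x, y} \<in> E" using leaf by (auto simp: nbrs_def)
  thus "x \<noteq> y" using forest_edge_neq E by metis
qed

lemma leaf_not_in_edge: "e \<in> E \<Longrightarrow> e \<noteq> {x, y} \<Longrightarrow> x \<notin> e"
  using forest_nbrs_edge[OF E leaf] by metis

lemma cover_at_leaf:
  assumes D: "cover E l D" and d: "d \<in> D" "x \<in> d"
  shows "d \<subseteq> {x, y}"
proof (cases "d \<in> E")
  case True
  thus ?thesis using leaf_not_in_edge d by blast
next
  case False
  thus ?thesis using coverD(2)[OF D] d by auto
qed

text \<open>Moving everything a cover does at the leaf to its neighbour never hurts the other edges.\<close>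

lemma cover_shift:
  assumes D: "cover E l D"
  obtains D' where "finite D'" "card D' \<le> card D" "D' \<subseteq> (E - {{x, y}}) \<union> range (\<lambda>v. {v})"
    "\<And>v. v \<in> \<Union>D \<Longrightarrow> v \<noteq> x \<Longrightarrow> v \<in> \<Union>D'" "x \<in> \<Union>D \<Longrightarrow> y \<in> \<Union>D'"
proof
  let ?f = "\<lambda>d. if x \<in> d then {y} else d"
  have fin: "finite D" using coverD(1)[OF D] .
  show "finite (?f ` D)" using fin by simp
  show "card (?f ` D) \<le> card D" using fin by (rule card_image_le)
  show "?f ` D \<subseteq> (E - {{x, y}}) \<union> range (\<lambda>v. {v})" using coverD(2)[OF D] by auto
  show "v \<in> \<Union>(?f ` D)" if v: "v \<in> \<Union>D" "v \<noteq> x" for v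
  proof -
    obtain d where "d \<in> D" "v \<in> d" using v by blast
    hence "v \<in> ?f d" using cover_at_leaf[OF D, of d] v(2) by auto
    thus ?thesis using \<open>d \<in> D\<close> by blast
  qed
  show "x \<in> \<Union>D \<Longrightarrow> y \<in> \<Union>(?f ` D)" by auto
qed

text \<open>The label of \<open>x\<close> settles the leaf edge; what a cover does at
  \<open>x\<close> can then serve only \<open>y\<close>, and \<open>cover_shift\<close> does it
  there.\<close>

lemma cover_number_leaf_covered:
  assumes "l x = 2"
  shows "cover_number E l = cover_number (E - {{x, y}}) l"
proof (rule cover_number_eqI)
  fix D assume D: "cover E l D"
  obtain D' where D': "finite D'" "card D' \<le> card D" "D' \<subseteq> (E - {{x, y}}) \<union> range (\<lambda>v. {v})"
    "\<And>v. v \<in> \<Union>D \<Longrightarrow> v \<noteq> x \<Longrightarrow> v \<in> \<Union>D'" using cover_shift[OF D] by metis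
  have "cover (E - {{x, y}}) l D'"
  proof (rule coverI[OF D'(1,3)])
    fix v assume v: "l v = 1"
    hence "v \<noteq> x" using assms by auto
    thus "v \<in> \<Union>D'" using coverD(3)[OF D v] D'(4) by blast
  next
    fix e assume e: "e \<in> E - {{x, y}}"
    then obtain v where v: "v \<in> e" "l v = 2 \<or> v \<in> \<Union>D" using coverD(4)[OF D] by blast
    have "v \<noteq> x" using leaf_not_in_edge[of e] e v(1) by auto
    thus "\<exists>v\<in>e. l v = 2 \<or> v \<in> \<Union>D'" using v D'(4) by blast
  qed
  thus "\<exists>D'. cover (E - {{x, y}}) l D' \<and> card D' \<le> card D" using D'(2) by blast
next
  fix D assume D: "cover (E - {{x, y}}) l D"
  show "cover E l D"
  proof (rule coverI)
    show "D \<subseteq> E \<union> range (\<lambda>v. {v})" using coverD(2)[OF D] by blast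
    fix e assume "e \<in> E"
    show "\<exists>v\<in>e. l v = 2 \<or> v \<in> \<Union>D"
    proof (cases "e = {x, y}")
      case True
      thus ?thesis using assms by simp
    next
      case False
      thus ?thesis using coverD(4)[OF D, of e] \<open>e \<in> E\<close> by simp
    qed
  qed (use coverD(1,3)[OF D] in auto)
qed

text \<open>Unless \<open>y\<close> counts as covered, a cover must contain an end of the leaf edge,
  and by \<open>cover_shift\<close> this may be \<open>y\<close>. So the edge is traded for a demand
  at \<open>y\<close>.\<close>

lemma cover_number_leaf_free:
  assumes "l x = 0" "l y \<le> 2" and l': "l' = (if l y = 0 then l(y := 1) else l)"
  shows "cover_number E l = cover_number (E - {{x, y}}) l'"
proof (rule cover_number_eqI)
  fix D assume D: "cover E l D"
  obtain D' where D': "finite D'" "card D' \<le> card D" "D' \<subseteq> (E - {{x, y}}) \<union> range (\<lambda>v. {v})"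
    "\<And>v. v \<in> \<Union>D \<Longrightarrow> v \<noteq> x \<Longrightarrow> v \<in> \<Union>D'" "x \<in> \<Union>D \<Longrightarrow> y \<in> \<Union>D'" using cover_shift[OF D] by metis
  have "cover (E - {{x, y}}) l' D'"
  proof (rule coverI[OF D'(1,3)])
    fix v assume v: "l' v = 1"
    show "v \<in> \<Union>D'"
    proof (cases "v = y")
      case True
      hence "l y \<noteq> 2" using v l' by auto
      hence "x \<in> \<Union>D \<or> y \<in> \<Union>D" using coverD(4)[OF D leaf_edge(1)] assms(1) by auto
      thus ?thesis using D'(4)[of y] D'(5) leaf_edge(2) True by blast
    next
      case False
      hence "l v = 1" using v l' by (simp split: if_splits)
      moreover from this have "v \<noteq> x" using assms(1) by auto
      ultimately show ?thesis using coverD(3)[OF D] D'(4) by blast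
    qed
  next
    fix e assume e: "e \<in> E - {{x, y}}"
    then obtain v where v: "v \<in> e" "l v = 2 \<or> v \<in> \<Union>D" using coverD(4)[OF D] by blast
    have "v \<noteq> x" using leaf_not_in_edge[of e] e v(1) by auto
    moreover have "l v = 2 \<Longrightarrow> l' v = 2" using l' by auto
    ultimately show "\<exists>v\<in>e. l' v = 2 \<or> v \<in> \<Union>D'" using v D'(4) by blast
  qed
  thus "\<exists>D'. cover (E - {{x, y}}) l' D' \<and> card D' \<le> card D" using D'(2) by blast
next
  fix D assume D: "cover (E - {{x, y}}) l' D"
  have l: "l v = 1 \<Longrightarrow> l' v = 1" "l' v = 2 \<Longrightarrow> l v = 2" for v
    using l' by (auto split: if_splits)
  have "l' y = 1 \<or> l' y = 2" using assms(2) l' by auto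
  hence y: "l y = 2 \<or> y \<in> \<Union>D" using coverD(3)[OF D] l(2) by blast
  show "cover E l D"
  proof (rule coverI)
    show "D \<subseteq> E \<union> range (\<lambda>v. {v})" using coverD(2)[OF D] by blast
    fix e assume "e \<in> E"
    show "\<exists>v\<in>e. l v = 2 \<or> v \<in> \<Union>D"
    proof (cases "e = {x, y}")
      case True
      thus ?thesis using y by simp
    next
      case False
      hence "\<exists>v\<in>e. l' v = 2 \<or> v \<in> \<Union>D" using coverD(4)[OF D, of e] \<open>e \<in> E\<close> by simp
      thus ?thesis using l(2) by blast
    qed
  qed (use coverD(1,3)[OF D] l(1) in auto)
qed

text \<open>A cover must contain \<open>{x}\<close> or \<open>{x, y}\<close>. Dropping such members
  saves at least one and affects only \<open>x\<close> and \<open>y\<close>, now labelled 2;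
  conversely, adding \<open>{x, y}\<close> restores a cover.\<close>

lemma cover_number_leaf_needed:
  assumes "l x = 1" "finite {v. l v = 1}"
  shows "cover_number E l = Suc (cover_number (E - {{x, y}}) (l(x := 2, y := 2)))"
proof -
  let ?l = "l(x := 2, y := 2)"
  have down: "\<exists>D'. cover (E - {{x, y}}) ?l D' \<and> Suc (card D') \<le> card D" if D: "cover E l D" for D
  proof -
    let ?D = "{d \<in> D. x \<notin> d}"
    have fin: "finite D" using coverD(1)[OF D] .
    have "x \<in> \<Union>D" using coverD(3)[OF D assms(1)] .
    hence "?D \<subset> D" by auto
    hence card: "card ?D < card D" using fin by (intro psubset_card_mono)
    have U: "v \<in> \<Union>?D" if "v \<in> \<Union>D" "v \<noteq> x" "v \<noteq> y" for v
      using that cover_at_leaf[OF D] by blast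
    have "cover (E - {{x, y}}) ?l ?D"
    proof (rule coverI)
      show "finite ?D" using fin by simp
      show "?D \<subseteq> (E - {{x, y}}) \<union> range (\<lambda>v. {v})" using coverD(2)[OF D] by auto
      fix v assume "?l v = 1"
      hence v: "l v = 1" "v \<noteq> x" "v \<noteq> y" by (auto split: if_splits)
      show "v \<in> \<Union>?D" using U[OF coverD(3)[OF D v(1)] v(2,3)] .
    next
      fix e assume "e \<in> E - {{x, y}}"
      then obtain v where v: "v \<in> e" "l v = 2 \<or> v \<in> \<Union>D" using coverD(4)[OF D] by blast
      have "?l v = 2 \<or> v \<in> \<Union>?D" using v(2) U[of v] by (cases "v = x \<or> v = y") auto
      thus "\<exists>v\<in>e. ?l v = 2 \<or> v \<in> \<Union>?D" using v(1) by blast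
    qed
    thus ?thesis using card Suc_le_eq by blast
  qed
  have up: "cover E l (insert {x, y} D)" if D: "cover (E - {{x, y}}) ?l D" for D
  proof (rule coverI)
    show "finite (insert {x, y} D)" using coverD(1)[OF D] by simp
    show "insert {x, y} D \<subseteq> E \<union> range (\<lambda>v. {v})"
      using coverD(2)[OF D] leaf_edge(1) by blast
    fix v assume "l v = 1"
    thus "v \<in> \<Union>(insert {x, y} D)"
      using coverD(3)[OF D, of v] by (cases "v = x \<or> v = y") auto
  next
    fix e assume "e \<in> E"
    show "\<exists>v\<in>e. l v = 2 \<or> v \<in> \<Union>(insert {x, y} D)"
    proof (cases "e = {x, y}")
      case False
      then obtain v where v: "v \<in> e" "?l v = 2 \<or> v \<in> \<Union>D"
        using coverD(4)[OF D, of e] \<open>e \<in> E\<close> by blast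
      have "l v = 2 \<or> v \<in> \<Union>(insert {x, y} D)" using v(2) by (auto split: if_splits)
      thus ?thesis using v(1) by blast
    qed simp
  qed
  have iff: "(\<exists>D. cover E l D \<and> card D \<le> Suc k) \<longleftrightarrow>
      (\<exists>D. cover (E - {{x, y}}) ?l D \<and> card D \<le> k)" for k
  proof
    assume "\<exists>D. cover E l D \<and> card D \<le> Suc k"
    then obtain D where D: "cover E l D" "card D \<le> Suc k" by blast
    obtain D' where "cover (E - {{x, y}}) ?l D'" "Suc (card D') \<le> card D" using down[OF D(1)] by blast
    moreover from this(2) D(2) have "card D' \<le> k" by linarith
    ultimately show "\<exists>D. cover (E - {{x, y}}) ?l D \<and> card D \<le> k" by blast
  next
    assume "\<exists>D. cover (E - {{x, y}}) ?l D \<and> card D \<le> k"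
    then obtain D where D: "cover (E - {{x, y}}) ?l D" "card D \<le> k" by blast
    have "card (insert {x, y} D) \<le> Suc (card D)" by (simp add: card_insert_if coverD(1)[OF D(1)])
    hence "card (insert {x, y} D) \<le> Suc k" using D(2) by linarith
    thus "\<exists>D. cover E l D \<and> card D \<le> Suc k" using up[OF D(1)] by blast
  qed
  \<comment> \<open>The shift of thresholds passes to the minima because some cover exists and, by
    \<open>down\<close>, none has size 0.\<close>
  obtain D where D: "cover E l D" using cover_exists[OF E assms(2)] by blast
  hence "\<exists>D'. cover E l D' \<and> card D' \<le> card D" by blast
  moreover have "\<not> (\<exists>D'. cover E l D' \<and> card D' \<le> 0)"
  proof
    assume "\<exists>D'. cover E l D' \<and> card D' \<le> 0"
    then obtain D' where "cover E l D'" "card D' \<le> 0" by blast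
    thus False using down[of D'] by simp
  qed
  ultimately show ?thesis unfolding cover_number_def iff[symmetric] by (rule Least_Suc)
qed

end

text \<open>Without edges only singletons are available, so each demanded vertex needs its own. This
  evaluates the problem left when the program stops.\<close>

lemma cover_number_empty:
  assumes "finite {v. l v = 1}"
  shows "cover_number {} l = card {v. l v = 1}"
  unfolding cover_number_def
proof (rule Least_equality)
  have "cover {} l ((\<lambda>v. {v}) ` {v. l v = 1})" using assms by (auto simp: cover_def)
  thus "\<exists>D. cover {} l D \<and> card D \<le> card {v. l v = 1}" using card_image_le[OF assms] by blast
  fix k assume "\<exists>D. cover {} l D \<and> card D \<le> k"
  then obtain D where D: "cover {} l D" "card D \<le> k" by blast
  have "(\<lambda>v. {v}) ` {v. l v = 1} \<subseteq> D" using D by (force simp: cover_def)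
  hence "card ((\<lambda>v. {v}) ` {v. l v = 1}) \<le> card D"
    using D card_mono by (auto simp: cover_def)
  thus "card {v. l v = 1} \<le> k" using D by (simp add: card_image)
qed

section \<open>Reasoning about programs\<close>

text \<open>\<open>run\<close> is meaningful for loop-free programs only; \<open>fits\<close> excludes the others.\<close>

fun run :: "com \<Rightarrow> state \<Rightarrow> state" where
  "run Skip s = s"
| "run (Assign r e) s = set_reg r (expr_val e s) s"
| "run (Write a r e) s = set_cell a (regs s r) (expr_val e s) s"
| "run (Seq c1 c2) s = run c2 (run c1 s)"
| "run (Cond b c1 c2) s = (if test_val b s then run c1 s else run c2 s)"
| "run (While b c) s = s"

fun fits :: "nat \<Rightarrow> com \<Rightarrow> state \<Rightarrow> bool" where
  "fits w Skip s \<longleftrightarrow> True"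
| "fits w (Assign r e) s \<longleftrightarrow> expr_val e s \<le> w"
| "fits w (Write a r e) s \<longleftrightarrow> expr_val e s \<le> w"
| "fits w (Seq c1 c2) s \<longleftrightarrow> fits w c1 s \<and> fits w c2 (run c1 s)"
| "fits w (Cond b c1 c2) s \<longleftrightarrow> (if test_val b s then fits w c1 s else fits w c2 s)"
| "fits w (While b c) s \<longleftrightarrow> False"

text \<open>An upper bound only: a conditional is charged for both branches, which is still a
  constant of the program text.\<close>

fun cost :: "com \<Rightarrow> nat" where
  "cost (Seq c1 c2) = cost c1 + cost c2"
| "cost (Cond b c1 c2) = 1 + cost c1 + cost c2"
| "cost c = 1"

lemma fits_exec: "fits w c s \<Longrightarrow> \<exists>t. exec w c s t (run c s) \<and> t \<le> cost c"
proof (induction c arbitrary: s)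
  case (Seq c1 c2)
  then obtain t1 t2 where t: "exec w c1 s t1 (run c1 s)" "t1 \<le> cost c1"
      "exec w c2 (run c1 s) t2 (run c2 (run c1 s))" "t2 \<le> cost c2"
    by (metis fits.simps(4))
  have "exec w (Seq c1 c2) s (t1 + t2) (run (Seq c1 c2) s)" using exec.Seq[OF t(1,3)] by simp
  moreover have "t1 + t2 \<le> cost (Seq c1 c2)" using t(2,4) by simp
  ultimately show ?case by blast
next
  case (Cond b c1 c2)
  show ?case
  proof (cases "test_val b s")
    case True
    then obtain t where t: "exec w c1 s t (run c1 s)" "t \<le> cost c1" using Cond by fastforce
    thus ?thesis using True exec.CondTrue[OF True t(1), of c2]
      by (intro exI[of _ "1 + t"]) simp
  next
    case False
    then obtain t where t: "exec w c2 s t (run c2 s)" "t \<le> cost c2" using Cond by fastforce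
    thus ?thesis using False exec.CondFalse[OF False t(1), of c1]
      by (intro exI[of _ "1 + t"]) simp
  qed
qed (auto intro: exec.intros)

text \<open>\<open>k\<close> is a potential bounding the remaining iterations: each drop pays for
  one body and its test, and the extra 1 is the final failing test.\<close>

lemma while_exec:
  assumes step: "\<And>k s. I k s \<Longrightarrow> test_val b s \<Longrightarrow> fits w c s \<and> (\<exists>k'<k. I k' (run c s))"
  shows "I k s \<Longrightarrow>
    \<exists>k' t s'. exec w (While b c) s t s' \<and> t \<le> 1 + (cost c + 1) * k \<and> I k' s' \<and> \<not> test_val b s'"
proof (induction k arbitrary: s rule: less_induct)
  case (less k)
  show ?case
  proof (cases "test_val b s")
    case False
    thus ?thesis using less.prems exec.WhileFalse[OF False] by (metis le_add1)
  next
    case True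
    obtain j where j: "j < k" "I j (run c s)" using step[OF less.prems True] by blast
    obtain t1 where t1: "exec w c s t1 (run c s)" "t1 \<le> cost c"
      using fits_exec step[OF less.prems True] by blast
    obtain k' t s' where t: "exec w (While b c) (run c s) t s'" "t \<le> 1 + (cost c + 1) * j"
        "I k' s'" "\<not> test_val b s'"
      using less.IH[OF j] by blast
    have "1 + t1 + t \<le> 1 + (cost c + 1) * (j + 1)" using t1 t by (simp add: algebra_simps)
    also have "\<dots> \<le> 1 + (cost c + 1) * k" using j(1) mult_le_mono2[of "j + 1" k "cost c + 1"] by simp
    finally show ?thesis using exec.WhileTrue[OF True t1(1) t(1)] t(3,4) by blast
  qed
qed

section \<open>The program\<close>

text \<open>
  Arrays 2 and 3 hold for every vertex the number and the sum of its current neighbours, so that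
  the only neighbour of a leaf is read off array 3. Array 4 holds the labels. The leaf loop walks
  from a removed leaf (register 2) to its neighbour as long as that has become a leaf, and
  otherwise proceeds to the next vertex in register 1. Register 4 is the number of edges chosen
  so far plus the number of vertices labelled 1.
\<close>

abbreviation (input) then_do :: "com \<Rightarrow> com \<Rightarrow> com" (infixr ";;" 60) where
  "c ;; d \<equiv> Seq c d"

definition add_edge :: com where
  "add_edge =
    Assign 2 (Opd (Cell 0 1)) ;; Assign 3 (Opd (Cell 1 1)) ;;
    Cond (Equal (Reg 2) (Reg 3)) Skip
     (Write 2 2 (Add (Cell 2 2) (Const 1)) ;; Write 2 3 (Add (Cell 2 3) (Const 1)) ;;
      Write 3 2 (Add (Cell 3 2) (Reg 3)) ;; Write 3 3 (Add (Cell 3 3) (Reg 2))) ;;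
    Assign 1 (Add (Reg 1) (Const 1))"

definition delete_leaf :: com where
  "delete_leaf =
    Assign 3 (Opd (Cell 3 2)) ;;
    Write 2 2 (Opd (Const 0)) ;; Write 3 2 (Opd (Const 0)) ;;
    Write 2 3 (Sub (Cell 2 3) (Const 1)) ;; Write 3 3 (Sub (Cell 3 3) (Reg 2))"

definition relabel :: com where
  "relabel =
    Cond (Equal (Cell 4 2) (Const 0))
     (Cond (Equal (Cell 4 3) (Const 0))
       (Write 4 3 (Opd (Const 1)) ;; Assign 4 (Add (Reg 4) (Const 1)))
       Skip)
     (Cond (Equal (Cell 4 2) (Const 1))
       (Cond (Equal (Cell 4 3) (Const 1)) (Assign 4 (Sub (Reg 4) (Const 1))) Skip ;;
        Write 4 2 (Opd (Const 2)) ;; Write 4 3 (Opd (Const 2)))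
       Skip)"

definition process_vertex :: com where
  "process_vertex =
    Cond (Equal (Cell 2 2) (Const 1))
     (delete_leaf ;; relabel ;; Assign 2 (Opd (Reg 3)))
     (Assign 1 (Add (Reg 1) (Const 1)) ;; Assign 2 (Opd (Reg 1)))"

definition program :: com where
  "program =
    While (Less (Reg 1) (Reg 0)) add_edge ;;
    Assign 1 (Opd (Const 0)) ;; Assign 2 (Opd (Const 0)) ;;
    While (Less (Reg 1) (Reg 0)) process_vertex ;;
    Assign 0 (Opd (Reg 4))"

section \<open>State updates and what the arrays represent\<close>

lemma set_sel [simp]:
  "regs (set_reg r x s) = (regs s)(r := x)" "arrays (set_reg r x s) = arrays s"
  "regs (set_cell a i x s) = regs s"
  "arrays (set_cell a i x s) = (arrays s)(a := (arrays s a)(i := x))"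
  by (simp_all add: set_reg_def set_cell_def)

lemma nbrs_insert:
  assumes "a \<noteq> b"
  shows "nbrs (insert {a, b} E) = (nbrs E)(a := insert b (nbrs E a), b := insert a (nbrs E b))"
proof
  fix v
  have "{v, u} = {a, b} \<longleftrightarrow> v = a \<and> u = b \<or> v = b \<and> u = a" for u
    by (rule doubleton_eq_iff)
  hence "nbrs (insert {a, b} E) v = {u. v = a \<and> u = b \<or> v = b \<and> u = a} \<union> nbrs E v"
    by (auto simp only: nbrs_def insert_iff)
  thus "nbrs (insert {a, b} E) v = ((nbrs E)(a := insert b (nbrs E a), b := insert a (nbrs E b))) v"
    using assms by (cases "v = a"; cases "v = b") auto
qed

lemma nbrs_remove:
  assumes "a \<noteq> b"
  shows "nbrs (E - {{a, b}}) = (nbrs E)(a := nbrs E a - {b}, b := nbrs E b - {a})"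
proof
  fix v
  have "{v, u} = {a, b} \<longleftrightarrow> v = a \<and> u = b \<or> v = b \<and> u = a" for u
    by (rule doubleton_eq_iff)
  hence "nbrs (E - {{a, b}}) v = nbrs E v - {u. v = a \<and> u = b \<or> v = b \<and> u = a}"
    by (auto simp only: nbrs_def Diff_iff singleton_iff)
  thus "nbrs (E - {{a, b}}) v = ((nbrs E)(a := nbrs E a - {b}, b := nbrs E b - {a})) v"
    using assms by (cases "v = a"; cases "v = b") auto
qed

text \<open>For edges among the \<open>n\<close> vertices both right-hand sides vanish elsewhere, in
  agreement with arrays that are initially 0.\<close>

definition adjacency :: "nat set set \<Rightarrow> state \<Rightarrow> bool" where
  "adjacency E s \<longleftrightarrow> arrays s 2 = (\<lambda>v. card (nbrs E v)) \<and> arrays s 3 = (\<lambda>v. \<Sum>(nbrs E v))"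

text \<open>\<open>c\<close> counts the edges chosen so far, so \<open>r\<close> is the answer once
  no edge is left. The bound on \<open>r + card E\<close> keeps \<open>r\<close> within a word: a
  deletion raises \<open>r\<close> by at most one.\<close>

definition progress :: "nat \<Rightarrow> nat set set \<Rightarrow> nat set set \<Rightarrow> (nat \<Rightarrow> nat) \<Rightarrow> nat \<Rightarrow> bool" where
  "progress n E0 E l r \<longleftrightarrow> (\<forall>v. l v \<le> 2) \<and> {v. l v = 1} \<subseteq> {..<n} \<and> r + card E \<le> n \<and>
     (\<exists>c. cover_number E0 (\<lambda>_. 0) = c + cover_number E l \<and> r = c + card {v. l v = 1})"

lemma card_Diff_edge: "forest E \<Longrightarrow> e \<in> E \<Longrightarrow> card E = Suc (card (E - {e}))"
  unfolding forest_def by (metis card_Suc_Diff1)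

lemma relabel_correct:
  assumes E: "forest E" and leaf: "nbrs E (regs s 2) = {regs s 3}" and "regs s 3 < n"
    and P: "progress n E0 E (arrays s 4) (regs s 4)"
  shows "fits ((n + 1) ^ 2) relabel s \<and> (\<exists>l r. progress n E0 (E - {{regs s 2, regs s 3}}) l r \<and>
    regs (run relabel s) = (regs s)(4 := r) \<and> arrays (run relabel s) = (arrays s)(4 := l))"
proof -
  let ?x = "regs s 2" and ?y = "regs s 3" and ?l = "arrays s 4" and ?r = "regs s 4"
  let ?E = "E - {{?x, ?y}}" and ?N = "{v. ?l v = 1}"
  note edge = leaf_edge[OF E leaf]
  have cE: "card E = Suc (card ?E)" using card_Diff_edge[OF E edge(1)] .
  obtain c where P': "\<And>v. ?l v \<le> 2" "?N \<subseteq> {..<n}" "?r + card E \<le> n"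
    "cover_number E0 (\<lambda>_. 0) = c + cover_number E ?l" "?r = c + card ?N"
    using P unfolding progress_def by blast
  have fin: "finite ?N" using P'(2) finite_subset by blast
  have w: "k \<le> (n + 1) ^ 2" if "k \<le> n + 1" for k
    using that by (simp add: power2_eq_square)
  consider "?l ?x = 0" "?l ?y = 0" | "?l ?x = 0" "?l ?y \<noteq> 0" | "?l ?x = 1" | "?l ?x = 2"
    using P'(1)[of ?x] by linarith
  thus ?thesis
  proof cases
    case 1
    let ?l' = "?l(?y := 1)"
    have "{v. ?l' v = 1} = insert ?y ?N" by auto
    hence "card {v. ?l' v = 1} = Suc (card ?N)" using fin 1 by simp
    moreover have "cover_number E ?l = cover_number ?E ?l'"
      using cover_number_leaf_free[OF E leaf, of ?l ?l'] 1 P'(1) by simp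
    moreover have "{v. ?l' v = 1} \<subseteq> {..<n}" using P'(2) assms(3) by auto
    ultimately have "progress n E0 ?E ?l' (?r + 1)"
      unfolding progress_def using P' cE by (intro conjI exI[of _ c]) auto
    moreover have "fits ((n + 1) ^ 2) relabel s" using 1 w P'(3) by (simp add: relabel_def)
    moreover have "regs (run relabel s) = (regs s)(4 := ?r + 1)"
      "arrays (run relabel s) = (arrays s)(4 := ?l')" using 1 by (simp_all add: relabel_def)
    ultimately show ?thesis by blast
  next
    case 2
    have "cover_number E ?l = cover_number ?E ?l"
      using cover_number_leaf_free[OF E leaf, of ?l ?l] 2 P'(1) by simp
    hence "progress n E0 ?E ?l ?r"
      unfolding progress_def using P' cE by (intro conjI exI[of _ c]) auto
    moreover have "fits ((n + 1) ^ 2) relabel s" using 2 by (simp add: relabel_def)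
    moreover have "regs (run relabel s) = (regs s)(4 := ?r)"
      "arrays (run relabel s) = (arrays s)(4 := ?l)" using 2 by (simp_all add: relabel_def)
    ultimately show ?thesis by blast
  next
    case 3
    let ?l' = "?l(?x := 2, ?y := 2)"
    \<comment> \<open>The chosen edge raises \<open>c\<close> by one and ends the demand at
      \<open>x\<close>, which cancels; only a demand at \<open>y\<close> changes the
      register.\<close>
    define r where "r = (if ?l ?y = 1 then ?r - 1 else ?r)"
    have N': "{v. ?l' v = 1} = ?N - {?x} - {?y}" by auto
    have "card ?N = Suc (card (?N - {?x}))"
      by (rule card_Suc_Diff1[symmetric]) (use fin 3 in auto)
    moreover have "card (?N - {?x}) = (if ?l ?y = 1 then Suc (card {v. ?l' v = 1}) else card {v. ?l' v = 1})"
    proof (cases "?l ?y = 1")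
      case True
      hence "Suc (card (?N - {?x} - {?y})) = card (?N - {?x})"
        using fin edge(2) by (intro card_Suc_Diff1) auto
      thus ?thesis unfolding N' using True by simp
    next
      case False
      hence "?N - {?x} - {?y} = ?N - {?x}" by auto
      thus ?thesis unfolding N' using False by simp
    qed
    ultimately have "r = Suc c + card {v. ?l' v = 1}" using P'(5) by (simp add: r_def)
    moreover have "cover_number E ?l = Suc (cover_number ?E ?l')"
      using cover_number_leaf_needed[OF E leaf, of ?l] 3 fin by simp
    moreover have "{v. ?l' v = 1} \<subseteq> {..<n}" using P'(2) N' by auto
    moreover have "r \<le> ?r" by (simp add: r_def)
    ultimately have "progress n E0 ?E ?l' r"
      unfolding progress_def using P' cE by (intro conjI exI[of _ "Suc c"]) auto
    moreover have "fits ((n + 1) ^ 2) relabel s"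
      using 3 w assms(3) P'(3) by (simp add: relabel_def)
    moreover have "regs (run relabel s) = (regs s)(4 := r)"
      "arrays (run relabel s) = (arrays s)(4 := ?l')" using 3 by (simp_all add: relabel_def r_def)
    ultimately show ?thesis by blast
  next
    case 4
    have "cover_number E ?l = cover_number ?E ?l"
      using cover_number_leaf_covered[OF E leaf, of ?l] 4 by simp
    hence "progress n E0 ?E ?l ?r"
      unfolding progress_def using P' cE by (intro conjI exI[of _ c]) auto
    moreover have "fits ((n + 1) ^ 2) relabel s" using 4 by (simp add: relabel_def)
    moreover have "regs (run relabel s) = (regs s)(4 := ?r)"
      "arrays (run relabel s) = (arrays s)(4 := ?l)" using 4 by (simp_all add: relabel_def)
    ultimately show ?thesis by blast
  qed
qed

section \<open>Word bounds and the leaf loop\<close>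

context
  fixes n :: nat and E0 :: "nat set set"
  assumes E0: "forest E0" "\<Union>E0 \<subseteq> {..<n}"
begin

lemma nbrs_below: "E \<subseteq> E0 \<Longrightarrow> nbrs E v \<subseteq> {..<n}"
  using nbrs_subset[of E v] E0(2) by blast

lemma finite_nbrs: "E \<subseteq> E0 \<Longrightarrow> finite (nbrs E v)"
  by (rule finite_subset[OF nbrs_below finite_lessThan])

lemma card_nbrs_le: "E \<subseteq> E0 \<Longrightarrow> card (nbrs E v) \<le> n"
  using card_mono[OF finite_lessThan nbrs_below, of E v] by simp

lemma sum_nbrs_le:
  assumes "E \<subseteq> E0"
  shows "\<Sum>(nbrs E v) \<le> n * n"
proof -
  have "\<Sum>(nbrs E v) \<le> of_nat (card (nbrs E v)) * n"
    using nbrs_below[OF assms, of v] by (intro sum_bounded_above) auto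
  also have "\<dots> \<le> n * n" using card_nbrs_le[OF assms] by simp
  finally show ?thesis .
qed

lemma card_forest_le: "card E0 \<le> n"
  using forest_card_le[OF E0(1)] card_mono[OF _ E0(2)] by simp

text \<open>The exponent 2 is due to the neighbour sums: they are at most \<open>n * n\<close>, and
  adding one more vertex stays below \<open>(Suc n) ^ 2\<close>.\<close>

lemma le_word: "k \<le> n * n + 2 * n + 1 \<Longrightarrow> k \<le> (Suc n) ^ 2"
  by (simp add: power2_eq_square)

lemma edge_less: "E \<subseteq> E0 \<Longrightarrow> {a, b} \<in> E \<Longrightarrow> a < n \<and> b < n"
  using E0(2) by blast

lemma delete_leaf_correct:
  assumes E: "E \<subseteq> E0" and leaf: "nbrs E (regs s 2) = {y}" and adj: "adjacency E s"
  shows "fits ((n + 1) ^ 2) delete_leaf s" "regs (run delete_leaf s) = (regs s)(3 := y)"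
    "adjacency (E - {{regs s 2, y}}) (run delete_leaf s)"
    "arrays (run delete_leaf s) 4 = arrays s 4"
proof -
  let ?x = "regs s 2"
  note edge = leaf_edge[OF forest_subset[OF E0(1) E] leaf]
  have A: "arrays s 2 = (\<lambda>v. card (nbrs E v))" "arrays s 3 = (\<lambda>v. \<Sum>(nbrs E v))"
    using adj by (simp_all add: adjacency_def)
  have y: "arrays s 3 ?x = y" using A(2) leaf by simp
  have lt: "?x < n" "y < n" using edge_less[OF E edge(1)] by simp_all
  have bounds: "arrays s 2 v \<le> n" "arrays s 3 v \<le> n * n" for v
    using card_nbrs_le[OF E] sum_nbrs_le[OF E] A by simp_all
  show "fits ((n + 1) ^ 2) delete_leaf s"
    using y lt edge(2) bounds(1)[of y] bounds(2)[of y]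
    by (auto simp: delete_leaf_def intro!: le_word)
  show "regs (run delete_leaf s) = (regs s)(3 := y)" "arrays (run delete_leaf s) 4 = arrays s 4"
    using y by (simp_all add: delete_leaf_def)
  have "?x \<in> nbrs E y" using edge(1) by (simp add: nbrs_def insert_commute)
  hence "card (nbrs E y - {?x}) = card (nbrs E y) - 1" "\<Sum>(nbrs E y - {?x}) = \<Sum>(nbrs E y) - ?x"
    by (simp_all add: card_Diff_singleton sum_diff1_nat)
  thus "adjacency (E - {{?x, y}}) (run delete_leaf s)"
    using y edge(2) A leaf
    by (simp add: adjacency_def delete_leaf_def nbrs_remove[OF edge(2)] fun_eq_iff)
qed

text \<open>The potential \<open>k\<close> drops with each deletion and each advance of register 1.
  A deletion can create a leaf only at the neighbour, which becomes the exempt vertex in register 2.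
  At exit that register holds \<open>n\<close>, so no actual vertex is exempt.\<close>

definition leaf_inv :: "nat \<Rightarrow> state \<Rightarrow> bool" where
  "leaf_inv k s \<longleftrightarrow> (\<exists>E. E \<subseteq> E0 \<and> k = (n - regs s 1) + card E \<and> regs s 0 = n \<and> regs s 1 \<le> n \<and>
     (regs s 1 = n \<longrightarrow> regs s 2 = n) \<and>
     (\<forall>j\<le>regs s 1. j \<noteq> regs s 2 \<longrightarrow> card (nbrs E j) \<noteq> 1) \<and>
     adjacency E s \<and> progress n E0 E (arrays s 4) (regs s 4))"

lemma process_vertex_correct:
  assumes I: "leaf_inv k s" and b: "test_val (Less (Reg 1) (Reg 0)) s"
  shows "fits ((n + 1) ^ 2) process_vertex s \<and> (\<exists>k'<k. leaf_inv k' (run process_vertex s))"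
proof -
  obtain E where E: "E \<subseteq> E0" and k: "k = (n - regs s 1) + card E" and r: "regs s 0 = n"
    and old: "\<And>j. j \<le> regs s 1 \<Longrightarrow> j \<noteq> regs s 2 \<Longrightarrow> card (nbrs E j) \<noteq> 1"
    and adj: "adjacency E s" and P: "progress n E0 E (arrays s 4) (regs s 4)"
    using I unfolding leaf_inv_def by blast
  have i: "regs s 1 < n" using b r by simp
  have A: "arrays s 2 = (\<lambda>v. card (nbrs E v))" using adj by (simp add: adjacency_def)
  let ?x = "regs s 2"
  show ?thesis
  proof (cases "card (nbrs E ?x) = 1")
    case True
    then obtain y where leaf: "nbrs E ?x = {y}" by (auto simp: card_1_singleton_iff)
    note F = forest_subset[OF E0(1) E]
    note edge = leaf_edge[OF F leaf]
    let ?E = "E - {{?x, y}}" and ?s = "run delete_leaf s"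
    note del = delete_leaf_correct[OF E leaf adj]
    have y: "y < n" using edge_less[OF E edge(1)] by simp
    have "progress n E0 E (arrays ?s 4) (regs ?s 4)" using P del(2,4) by simp
    with relabel_correct[OF F, of ?s n E0] obtain l q
      where rel: "fits ((n + 1) ^ 2) relabel ?s" "progress n E0 ?E l q"
        "regs (run relabel ?s) = (regs ?s)(4 := q)" "arrays (run relabel ?s) = (arrays ?s)(4 := l)"
      using leaf y del(2) by auto
    let ?s' = "run process_vertex s"
    have s': "regs ?s' = (regs s)(3 := y, 4 := q, 2 := y)" "arrays ?s' = (arrays ?s)(4 := l)"
      using True A rel(3,4) del(2) by (simp_all add: process_vertex_def)
    have "fits ((n + 1) ^ 2) process_vertex s"
      using True A del(1,2) rel(1,3) y by (auto simp: process_vertex_def intro!: le_word)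
    moreover have "leaf_inv ((n - regs s 1) + card ?E) ?s'"
      unfolding leaf_inv_def
    proof (intro exI[of _ ?E] conjI allI impI)
      show "adjacency ?E ?s'" using del(3) s'(2) by (simp add: adjacency_def)
      show "progress n E0 ?E (arrays ?s' 4) (regs ?s' 4)" using rel(2) s' by simp
      fix j assume j: "j \<le> regs ?s' 1" "j \<noteq> regs ?s' 2"
      show "card (nbrs ?E j) \<noteq> 1"
        using j s'(1) old[of j] leaf by (cases "j = ?x") (auto simp: nbrs_remove[OF edge(2)])
    qed (use E i r s' in auto)
    moreover have "(n - regs s 1) + card ?E < k" using k card_Diff_edge[OF F edge(1)] by simp
    ultimately show ?thesis by blast
  next
    case False
    let ?s' = "run process_vertex s"
    have s': "regs ?s' = (regs s)(1 := Suc (regs s 1), 2 := Suc (regs s 1))" "arrays ?s' = arrays s"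
      using False A by (simp_all add: process_vertex_def)
    have "fits ((n + 1) ^ 2) process_vertex s"
      using False A i by (auto simp: process_vertex_def intro!: le_word)
    moreover have "leaf_inv ((n - Suc (regs s 1)) + card E) ?s'"
      unfolding leaf_inv_def
    proof (intro exI[of _ E] conjI allI impI)
      fix j assume j: "j \<le> regs ?s' 1" "j \<noteq> regs ?s' 2"
      show "card (nbrs E j) \<noteq> 1"
        using j s'(1) old[of j] False by (cases "j = ?x") auto
    qed (use E i r s' adj P in \<open>auto simp: adjacency_def\<close>)
    moreover have "(n - Suc (regs s 1)) + card E < k" using k i by simp
    ultimately show ?thesis by blast
  qed
qed

text \<open>At exit no vertex below \<open>n\<close> is a leaf, so by \<open>forest_leaf\<close> no
  edge remains, and \<open>cover_number_empty\<close> makes \<open>progress\<close> an exact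
  answer.\<close>

lemma leaf_inv_final:
  assumes I: "leaf_inv k s" and b: "\<not> test_val (Less (Reg 1) (Reg 0)) s"
  shows "regs s 4 = cover_number E0 (\<lambda>_. 0)" "regs s 4 \<le> n"
proof -
  obtain E where E: "E \<subseteq> E0" and r: "regs s 0 = n" "regs s 1 \<le> n" "regs s 1 = n \<longrightarrow> regs s 2 = n"
    and old: "\<And>j. j \<le> regs s 1 \<Longrightarrow> j \<noteq> regs s 2 \<Longrightarrow> card (nbrs E j) \<noteq> 1"
    and P: "progress n E0 E (arrays s 4) (regs s 4)"
    using I unfolding leaf_inv_def by blast
  have "E = {}"
  proof (rule ccontr)
    assume "E \<noteq> {}"
    then obtain x y where xy: "nbrs E x = {y}" using forest_leaf[OF forest_subset[OF E0(1) E]] by blast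
    hence "{x, y} \<in> E" by (auto simp: nbrs_def)
    hence "x < n" using edge_less[OF E] by blast
    moreover have "regs s 1 = n" "regs s 2 = n" using b r by simp_all
    ultimately show False using old[of x] xy by simp
  qed
  thus "regs s 4 = cover_number E0 (\<lambda>_. 0)" "regs s 4 \<le> n"
    using P cover_number_empty[of "arrays s 4"] finite_subset[of "{v. arrays s 4 v = 1}" "{..<n}"]
    by (auto simp: progress_def)
qed

section \<open>The input loop and the complete program\<close>

context
  fixes es :: "(nat \<times> nat) list"
  assumes es: "distinct (map (\<lambda>(u, v). {u, v}) es)" "set (map (\<lambda>(u, v). {u, v}) es) = E0"
begin

definition prefix_edges :: "nat \<Rightarrow> nat set set" where
  "prefix_edges i = set (take i (map (\<lambda>(u, v). {u, v}) es))"

definition init_inv :: "nat \<Rightarrow> state \<Rightarrow> bool" where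
  "init_inv k s \<longleftrightarrow> regs s 1 \<le> n \<and> k = n - regs s 1 \<and> regs s 0 = n \<and> regs s 4 = 0 \<and>
     adjacency (prefix_edges (regs s 1)) s \<and>
     (\<forall>a\<in>{0, 1, 4}. arrays s a = arrays (input_state n es) a)"

lemma prefix_edges_subset: "prefix_edges i \<subseteq> E0"
  unfolding prefix_edges_def es(2)[symmetric] by (rule set_take_subset)

lemma length_le: "length es \<le> n"
  using card_forest_le distinct_card[OF es(1)] es(2) by simp

lemma add_edge_correct:
  assumes I: "init_inv k s" and b: "test_val (Less (Reg 1) (Reg 0)) s"
  shows "fits ((n + 1) ^ 2) add_edge s \<and> (\<exists>k'<k. init_inv k' (run add_edge s))"
proof -
  let ?i = "regs s 1"
  let ?F = "prefix_edges ?i"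
  have r: "?i < n" "k = n - ?i" "regs s 0 = n" "regs s 4 = 0" and adj: "adjacency ?F s"
    and inp: "arrays s 0 = arrays (input_state n es) 0" "arrays s 1 = arrays (input_state n es) 1"
      "arrays s 4 = arrays (input_state n es) 4"
    using I b unfolding init_inv_def by auto
  have A: "arrays s 2 = (\<lambda>v. card (nbrs ?F v))" "arrays s 3 = (\<lambda>v. \<Sum>(nbrs ?F v))"
    using adj by (simp_all add: adjacency_def)
  let ?s' = "run add_edge s"
  have si: "Suc ?i \<le> (Suc n) ^ 2" using r(1) by (intro le_word) simp
  have "fits ((n + 1) ^ 2) add_edge s \<and> regs ?s' 0 = n \<and> regs ?s' 1 = Suc ?i \<and> regs ?s' 4 = 0 \<and>
    adjacency (prefix_edges (Suc ?i)) ?s' \<and> (\<forall>a\<in>{0, 1, 4}. arrays ?s' a = arrays s a)"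
  proof (cases "?i < length es")
    case False
    hence "prefix_edges (Suc ?i) = ?F" by (simp add: prefix_edges_def)
    \<comment> \<open>The length of the list is not part of the input, so \<open>n\<close> indices
      are scanned. Past the end both entries read 0, and equal ends, which no edge has, make
      \<open>add_edge\<close> skip them.\<close>
    moreover have "arrays s 0 ?i = 0" "arrays s 1 ?i = 0"
      using False inp by (simp_all add: input_state_def)
    ultimately show ?thesis
      using r si adj by (simp add: add_edge_def adjacency_def)
  next
    case True
    obtain a c where ac: "es ! ?i = (a, c)" by force
    have at: "arrays s 0 ?i = a" "arrays s (Suc 0) ?i = c"
      using True inp ac by (simp_all add: input_state_def)
    have "map (\<lambda>(u, v). {u, v}) es ! ?i = {a, c}" using True ac by simp
    hence F: "prefix_edges (Suc ?i) = insert {a, c} ?F"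
      using True by (simp add: prefix_edges_def take_Suc_conv_app_nth)
    have new: "{a, c} \<notin> ?F"
      using True es(1) \<open>map (\<lambda>(u, v). {u, v}) es ! ?i = {a, c}\<close> distinct_take[OF es(1), of "Suc ?i"]
      by (simp add: prefix_edges_def take_Suc_conv_app_nth)
    have in_E0: "{a, c} \<in> E0" using F prefix_edges_subset[of "Suc ?i"] by blast
    have neq: "a \<noteq> c" using forest_edge_neq[OF E0(1) in_E0] .
    have lt: "a < n" "c < n" using edge_less[OF subset_refl in_E0] by simp_all
    have nin: "c \<notin> nbrs ?F a" "a \<notin> nbrs ?F c" using new by (simp_all add: nbrs_def insert_commute)
    note fin = finite_nbrs[OF prefix_edges_subset[of ?i]]
    have bounds: "card (nbrs ?F v) \<le> n" "\<Sum>(nbrs ?F v) \<le> n * n" for v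
      using card_nbrs_le[OF prefix_edges_subset] sum_nbrs_le[OF prefix_edges_subset] by simp_all
    have "fits ((n + 1) ^ 2) add_edge s"
      using at neq lt A r(1) bounds[of a] bounds[of c] by (auto simp: add_edge_def intro!: le_word)
    moreover have "adjacency (prefix_edges (Suc ?i)) ?s'"
      using at neq A nin fin unfolding F
      by (auto simp: adjacency_def add_edge_def nbrs_insert[OF neq] fun_eq_iff)
    ultimately show ?thesis using at neq r by (simp add: add_edge_def)
  qed
  hence "fits ((n + 1) ^ 2) add_edge s" "init_inv (n - Suc ?i) ?s'"
    using r inp unfolding init_inv_def by auto
  moreover have "n - Suc ?i < k" using r by simp
  ultimately show ?thesis by blast
qed

text \<open>The 5 accounts for three assignments and two failing loop tests, and
  \<open>2 * n\<close> for \<open>n\<close> advances and at most \<open>n\<close> deletions in the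
  leaf loop.\<close>

lemma program_correct:
  "\<exists>t s. exec ((n + 1) ^ 2) program (input_state n es) t s \<and>
     t \<le> 5 + (cost add_edge + 1) * n + (cost process_vertex + 1) * (2 * n) \<and>
     result_of s = cover_number E0 (\<lambda>_. 0)"
proof -
  let ?w = "(n + 1) ^ 2" and ?b = "Less (Reg 1) (Reg 0)"
  have "init_inv n (input_state n es)"
    by (simp add: init_inv_def input_state_def adjacency_def prefix_edges_def nbrs_def)
  from while_exec[of init_inv ?b ?w add_edge, OF add_edge_correct this]
  obtain k1 t1 s1 where 1: "exec ?w (While ?b add_edge) (input_state n es) t1 s1"
    "t1 \<le> 1 + (cost add_edge + 1) * n" "init_inv k1 s1" "\<not> test_val ?b s1"
    by blast
  define s2 where "s2 = set_reg 1 0 s1"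
  define s3 where "s3 = set_reg 2 0 s2"
  have "exec ?w (Assign 1 (Opd (Const 0))) s1 1 s2"
    using exec.Assign[of "Opd (Const 0)" s1 ?w 1] by (simp add: s2_def)
  moreover have "exec ?w (Assign 2 (Opd (Const 0))) s2 1 s3"
    using exec.Assign[of "Opd (Const 0)" s2 ?w 2] by (simp add: s3_def)
  ultimately have 2: "exec ?w (Assign 1 (Opd (Const 0))) s1 1 s2"
    "exec ?w (Assign 2 (Opd (Const 0))) s2 1 s3" .
  have "regs s1 1 = n" using 1(3,4) by (simp add: init_inv_def)
  moreover have "prefix_edges n = E0" using length_le es(2) by (simp add: prefix_edges_def)
  ultimately have adj: "adjacency E0 s1" using 1(3) by (simp add: init_inv_def)
  have s1: "regs s1 0 = n" "regs s1 4 = 0" "arrays s1 4 = (\<lambda>_. 0)"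
    using 1(3) by (auto simp: init_inv_def input_state_def)
  have "leaf_inv (n + card E0) s3"
    unfolding leaf_inv_def using adj s1 card_forest_le
    by (intro exI[of _ E0]) (auto simp: s2_def s3_def adjacency_def progress_def)
  from while_exec[of leaf_inv ?b ?w process_vertex, OF process_vertex_correct this]
  obtain k4 t4 s4 where 4: "exec ?w (While ?b process_vertex) s3 t4 s4"
    "t4 \<le> 1 + (cost process_vertex + 1) * (n + card E0)" "leaf_inv k4 s4" "\<not> test_val ?b s4"
    by blast
  note fin = leaf_inv_final[OF 4(3,4)]
  have 5: "exec ?w (Assign 0 (Opd (Reg 4))) s4 1 (set_reg 0 (regs s4 4) s4)"
    using exec.Assign[of "Opd (Reg 4)" s4 ?w 0] fin(2) le_word[of "regs s4 4"] by simp
  have "exec ?w program (input_state n es) (t1 + (1 + (1 + (t4 + 1)))) (set_reg 0 (regs s4 4) s4)"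
    unfolding program_def by (rule exec.Seq[OF 1(1) exec.Seq[OF 2(1) exec.Seq[OF 2(2) exec.Seq[OF 4(1) 5]]]])
  moreover have "(cost process_vertex + 1) * (n + card E0) \<le> (cost process_vertex + 1) * (2 * n)"
    using card_forest_le by (intro mult_le_mono2) simp
  moreover have "result_of (set_reg 0 (regs s4 4) s4) = cover_number E0 (\<lambda>_. 0)"
    using fin(1) by (simp add: result_of_def)
  ultimately show ?thesis using 1(2) 4(2) by (intro exI conjI) (assumption, linarith)
qed

end

end

section \<open>Asymptotic form of the running time\<close>

lemma linear_bound_bigo:
  fixes a b :: nat
  shows "(\<lambda>n. real (5 + a * n + b * (2 * n))) \<in> O(\<lambda>n. real n)"
proof (rule bigoI[of _ "real (5 + a + 2 * b)"])
  have "norm (real (5 + a * n + b * (2 * n))) \<le> real (5 + a + 2 * b) * norm (real n)" if "n \<ge> 1" for n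
  proof -
    have "5 + a * n + b * (2 * n) \<le> (5 + a + 2 * b) * n" using that by (simp add: algebra_simps)
    hence "real (5 + a * n + b * (2 * n)) \<le> real ((5 + a + 2 * b) * n)" by (rule of_nat_mono)
    thus ?thesis by (simp only: of_nat_mult real_norm_def abs_of_nat)
  qed
  thus "\<forall>\<^sub>F n in at_top. norm (real (5 + a * n + b * (2 * n))) \<le> real (5 + a + 2 * b) * norm (real n)"
    by (rule eventually_sequentiallyI)
qed

theorem theorem2:
  "\<exists>(p :: com) (T :: nat \<Rightarrow> nat).
     (\<lambda>n. real (T n)) \<in> O(\<lambda>n. real n) \<and> computes_on_trees p unigraph_number T"
proof -
  let ?a = "cost add_edge + 1" and ?b = "cost process_vertex + 1"
  let ?T = "\<lambda>n. 5 + ?a * n + ?b * (2 * n)"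
  have "(\<lambda>n. real (?T n)) \<in> O(\<lambda>n. real n)" by (rule linear_bound_bigo)
  moreover have "computes_on_trees program unigraph_number ?T"
    unfolding computes_on_trees_def
  proof (rule exI[of _ 2], intro allI impI)
    fix n and G :: "nat graph" and es
    assume *: "is_tree G \<and> verts G = {..<n} \<and> edge_listing G es"
    hence F: "forest (edges G)" using tree_forest by blast
    have "\<Union>(edges G) \<subseteq> {..<n}" using * by (auto simp: is_tree_def simple_graph_def)
    from program_correct[OF F this, of es] *
    show "\<exists>t s. exec ((n + 1) ^ 2) program (input_state n es) t s \<and> t \<le> ?T n \<and>
        result_of s = unigraph_number G"
      by (simp add: edge_listing_def unigraph_number_eq_cover_number[OF F])
  qed
  ultimately show ?thesis by (intro exI[of _ program] exI[of _ ?T] conjI)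
qed

end
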